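(* Let $A\in\mathbb{R}^{n\times n}$ satisfy $A^\top=-A$ and let $T>0$. Then $\gamma_1(A,T)=\gamma_{\mathrm{rel}}(A,T)$ if and only if $A$ is cyclic and $e^{TA}=\sigma\,\mathrm{Id}$ for some $\sigma\in\{-1,1\}$. If $\ker A\neq\{0\}$, necessarily $\sigma=1$. When these conditions hold, let $\mathbb{R}^n=V_0\oplus\bigoplus_{\ell=1}^LV_\ell$ be the orthogonal decomposition in which $V_0=\ker A$ has dimension zero or one and every $V_\ell$, $\ell\geq1$, is a two-dimensional $A$-invariant plane on which $A$ acts, in an orthonormal basis, as $\omega_\ell J$ with distinct positive frequencies $\omega_1,\ldots,\omega_L$; let $P_0,\ldots,P_L$ be the corresponding orthogonal projectors. Then the unit vectors $b$ attaining $\gamma_1(A,T)=\max_{\Vert b\Vert=1}\lambda_{\min}(G_T(A,b))$ are exactly those satisfying $$\Vert P_0b\Vert^2=\frac1n\quad\text{if }\dim V_0=1,\qquad \Vert P_\ell b\Vert^2=\frac2n\quad\forall\ell\in\{1,\ldots,L\}.$$ (So the maximizing modal weights are unique, while the direction of $b$ inside each plane $V_\ell$ and its sign on $V_0$ are arbitrary.) Every such $b$ satisfies $G_T(A,b)=\frac{T}{n}\mathrm{Id}$.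
   Context: For $A\in\mathbb{R}^{n\times n}$, $T>0$ and $b\in\mathbb{R}^n$, $G_T(A,b)=\int_0^Te^{tA}bb^\top e^{tA^\top}\,dt$, $\gamma_1(A,T)=\max_{\Vert b\Vert=1}\lambda_{\min}(G_T(A,b))$, and $\gamma_{\mathrm{rel}}(A,T)=\max_{X\succeq0,\ \operatorname{tr}X=1}\lambda_{\min}\big(\int_0^Te^{tA}Xe^{tA^\top}dt\big)$ over real symmetric $X$. $A$ is cyclic if $\operatorname{span}(b,Ab,\ldots,A^{n-1}b)=\mathbb{R}^n$ for some $b$; for real skew-symmetric $A$ this is equivalent to simplicity of the complex spectrum, and then the orthogonal decomposition described in the claim exists. $J=\begin{pmatrix}0&-1\\1&0\end{pmatrix}$. *)

theory Defs
  imports "HOL-Analysis.Analysis"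
begin

(* On real^'n^'n the operations * and ^ of the library are componentwise, so the powers below
   iterate the matrix product **. *)

definition mat_pow :: "real^'n^'n \<Rightarrow> nat \<Rightarrow> real^'n^'n" where
  "mat_pow A k = ((**) A ^^ k) (mat 1)"

definition mat_exp :: "real^'n^'n \<Rightarrow> real^'n^'n" where
  "mat_exp A = (\<Sum>k. (1 / fact k) *\<^sub>R mat_pow A k)"

definition eigenvalues :: "real^'n^'n \<Rightarrow> real set" where
  "eigenvalues M = {l. \<exists>v. v \<noteq> 0 \<and> M *v v = l *\<^sub>R v}"

(* Only real eigenvalues are taken into account; lambda_min is applied to symmetric matrices only,
   for which this set is finite and nonempty and contains the whole spectrum. *)
definition lambda_min :: "real^'n^'n \<Rightarrow> real" where
  "lambda_min M = Min (eigenvalues M)"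

definition pos_semidef :: "real^'n^'n \<Rightarrow> bool" where
  "pos_semidef X \<longleftrightarrow> transpose X = X \<and> (\<forall>v. 0 \<le> v \<bullet> (X *v v))"

definition weighted_gramian :: "real^'n^'n \<Rightarrow> real \<Rightarrow> real^'n^'n \<Rightarrow> real^'n^'n" where
  "weighted_gramian A T X =
     integral {0..T} (\<lambda>t. mat_exp (t *\<^sub>R A) ** X ** mat_exp (t *\<^sub>R transpose A))"

definition gramian :: "real^'n^'n \<Rightarrow> real \<Rightarrow> real^'n \<Rightarrow> real^'n^'n" where
  "gramian A T b = weighted_gramian A T ((columnvector b :: real^1^'n) ** (rowvector b :: real^'n^1))"

(* The greatest elements in gamma_1 and gamma_rel exist by compactness of the unit sphere and of the
   set of positive semidefinite matrices of trace one. *)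

definition gamma_1 :: "real^'n^'n \<Rightarrow> real \<Rightarrow> real" where
  "gamma_1 A T = (GREATEST r. \<exists>b. norm b = 1 \<and> r = lambda_min (gramian A T b))"

definition gamma_rel :: "real^'n^'n \<Rightarrow> real \<Rightarrow> real" where
  "gamma_rel A T =
     (GREATEST r. \<exists>X. pos_semidef X \<and> trace X = 1 \<and> r = lambda_min (weighted_gramian A T X))"

definition cyclic :: "real^'n^'n \<Rightarrow> bool" where
  "cyclic A \<longleftrightarrow> (\<exists>b. span ((\<lambda>k. mat_pow A k *v b) ` {..<CARD('n)}) = UNIV)"

definition mat_ker :: "real^'n^'n \<Rightarrow> (real^'n) set" where
  "mat_ker A = {x. A *v x = 0}"

definition orth_proj :: "(real^'n) set \<Rightarrow> real^'n \<Rightarrow> real^'n" where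
  "orth_proj S x = (THE y. y \<in> S \<and> (\<forall>z\<in>S. orthogonal (x - y) z))"

definition J :: "real^2^2" where
  "J = vector [vector [0, -1], vector [1, 0]]"

(* The columns of w J are the coordinates of the images of the basis vectors, so A maps
   u 1 to w u 2 and u 2 to - w u 1. That S is a plane and that it is A-invariant follows. *)
definition acts_as_rotation :: "real^'n^'n \<Rightarrow> (real^'n) set \<Rightarrow> real \<Rightarrow> bool" where
  "acts_as_rotation A S w \<longleftrightarrow>
     (\<exists>u :: 2 \<Rightarrow> real^'n.
        (\<forall>i j. u i \<bullet> u j = (if i = j then 1 else 0)) \<and>
        span (range u) = S \<and>
        (\<forall>j. A *v u j = (\<Sum>i\<in>UNIV. (w *\<^sub>R J) $ i $ j *\<^sub>R u i)))"

definition modal_decomposition ::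
    "real^'n^'n \<Rightarrow> nat \<Rightarrow> (nat \<Rightarrow> (real^'n) set) \<Rightarrow> (nat \<Rightarrow> real) \<Rightarrow> bool" where
  "modal_decomposition A L V \<omega> \<longleftrightarrow>
     V 0 = mat_ker A \<and> dim (V 0) \<in> {0, 1} \<and>
     (\<forall>l\<in>{1..L}. 0 < \<omega> l \<and> acts_as_rotation A (V l) (\<omega> l)) \<and>
     inj_on \<omega> {1..L} \<and>
     (\<forall>i\<le>L. \<forall>j\<le>L. i \<noteq> j \<longrightarrow> (\<forall>x\<in>V i. \<forall>y\<in>V j. orthogonal x y)) \<and>
     span (\<Union>l\<le>L. V l) = UNIV"

end

(* Since e^{tA} is orthogonal, every weighted Gramian has trace T tr X. Hence lambda_min is at most
   T/n, with equality exactly when the Gramian is (T/n) Id, and gamma_rel = T/n is attained at X = Id/n.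
   So gamma_1 = gamma_rel iff G(b) = (T/n) Id for some unit b.

   The derivative of e^{tA} b b^T e^{-tA} is its commutator with A, so A G(b) - G(b) A equals
   e^{TA} b b^T e^{-TA} - b b^T. If G(b) is a positive multiple of Id, this vanishes and e^{TA} b = +-b;
   moreover b is a cyclic vector, because v orthogonal to all A^k b has v . G(b) v = 0. The sign carries
   over from b to all of R^n.

   Conversely, if e^{TA} = +-Id then G(b) commutes with A, so it is block diagonal for the eigenspaces
   of A^2 and a scalar on each plane V_l; comparing traces, the scalar is T |P_l b|^2 / dim V_l.
   It equals T/n for all l exactly for the stated modal weights. *)

theory Submission
  imports Defs
begin

section \<open>Symmetric matrices and their least eigenvalue\<close>

text \<open>Everything stays over the reals. The modes are obtained as eigenspaces of the symmetric
  matrix A^2, with eigenvalues -w^2, and not from complex eigenvectors of A; cyclicity is what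
  bounds their dimensions, by two for w > 0 and by one for the kernel. The exponential is
  differentiated through the scalar functions t |-> u . e^{tA} v, which are power series. Skewness
  then yields conserved quantities, so that neither the addition law of the exponential nor
  trigonometric integrals occur. In the converse direction the condition on e^{TA} is used through
  e^{TA} b b^T e^{-TA} = b b^T. This is quadratic in e^{TA}, so both signs are treated alike; only
  the kernel, which e^{TA} fixes, tells them apart. The numerators 1 and 2 of the weights are the
  dimensions of the modes.\<close>

lemma symmetric_matrix_inner:
  fixes M :: "real^'n^'n"
  assumes "transpose M = M"
  shows "x \<bullet> (M *v y) = (M *v x) \<bullet> y"
  using assms by (metis dot_lmul_matrix transpose_matrix_vector)

lemma skew_matrix_inner:
  fixes A :: "real^'n^'n"
  assumes "transpose A = - A"
  shows "x \<bullet> (A *v y) = - ((A *v x) \<bullet> y)"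
proof -
  have "x \<bullet> (A *v y) = (transpose A *v x) \<bullet> y"
    by (simp add: dot_lmul_matrix)
  also have "\<dots> = - ((A *v x) \<bullet> y)"
    using matrix_vector_mult_diff_rdistrib[of 0 A x] by (simp add: assms)
  finally show ?thesis .
qed

text \<open>The first-order condition at a minimum, in the form used for variations of a quadratic
  form: for small t of the sign opposite to a, the linear term would win.\<close>

lemma quadratic_nonneg_linear_coeff_zero:
  fixes a c :: real
  assumes "\<And>t. 0 \<le> 2 * t * a + t\<^sup>2 * c"
  shows "a = 0"
proof (rule ccontr)
  assume "a \<noteq> 0"
  \<comment> \<open>The choice t = -a/k turns the expression into (a^2/k^2)(c - 2k), so k only has
    to be positive and larger than c/2.\<close>
  define k where "k = \<bar>c\<bar> + 1"
  have k: "k > 0" "c < k" by (auto simp: k_def)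
  have "0 \<le> 2 * (- a / k) * a + (- a / k)\<^sup>2 * c" using assms .
  also have "\<dots> = (a\<^sup>2 / k\<^sup>2) * (c - 2 * k)"
    using k by (simp add: field_simps power2_eq_square)
  also have "\<dots> < 0"
    using k \<open>a \<noteq> 0\<close> by (intro mult_pos_neg) auto
  finally show False by simp
qed

lemma symmetric_quadratic_form_expand:
  fixes M :: "real^'n^'n"
  assumes "transpose M = M"
  shows "(x + t *\<^sub>R z) \<bullet> (M *v (x + t *\<^sub>R z)) =
           x \<bullet> (M *v x) + 2 * t * (z \<bullet> (M *v x)) + t\<^sup>2 * (z \<bullet> (M *v z))"
  using symmetric_matrix_inner[OF assms, of x z]
  by (simp add: matrix_vector_right_distrib matrix_vector_mult_scaleR inner_add_left inner_add_right
      power2_eq_square inner_commute[of x "M *v z"] inner_commute[of "M *v x" z] algebra_simps)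

text \<open>Compactness of the unit sphere of S gives a minimizer of the form, and the first
  variation makes it an eigenvector. S = \<open>UNIV\<close> serves for \<open>lambda_min\<close>; a
  general invariant S is there for the orthogonal complement of the eigenspaces of A^2.\<close>

lemma rayleigh_minimizer:
  fixes M :: "real^'n^'n"
  assumes sym: "transpose M = M" and S: "subspace S" "S \<noteq> {0}"
    and inv: "\<And>x. x \<in> S \<Longrightarrow> M *v x \<in> S"
  obtains x m where "x \<in> S" "norm x = 1" "M *v x = m *\<^sub>R x"
    "\<And>y. y \<in> S \<Longrightarrow> m * (y \<bullet> y) \<le> y \<bullet> (M *v y)"
proof -
  let ?K = "S \<inter> sphere 0 1"
  have "compact ?K"
    using S by (simp add: closed_Int_compact closed_subspace)
  obtain z where z: "z \<in> S" "z \<noteq> 0"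
    using S subspace_0 by blast
  then have "(1 / norm z) *\<^sub>R z \<in> ?K"
    using S by (simp add: subspace_scale)
  then have "?K \<noteq> {}" by blast
  have "continuous_on ?K (\<lambda>x. x \<bullet> (M *v x))"
    by (intro continuous_intros)
  then obtain x where x: "x \<in> ?K" and min: "\<And>y. y \<in> ?K \<Longrightarrow> x \<bullet> (M *v x) \<le> y \<bullet> (M *v y)"
    using continuous_attains_inf[OF \<open>compact ?K\<close> \<open>?K \<noteq> {}\<close>] by blast
  define m where "m = x \<bullet> (M *v x)"
  have le: "m * (y \<bullet> y) \<le> y \<bullet> (M *v y)" if "y \<in> S" for y
  proof (cases "y = 0")
    case False
    have "(1 / norm y) *\<^sub>R y \<in> ?K"
      using S that False by (simp add: subspace_scale)
    from min[OF this] show ?thesis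
      using False by (simp add: m_def matrix_vector_mult_scaleR dot_square_norm field_simps power2_eq_square)
  qed simp
  have xx: "x \<bullet> x = 1" "x \<in> S" using x by (auto simp: dot_square_norm)
  define r where "r = M *v x - m *\<^sub>R x"
  have "r \<in> S"
    unfolding r_def using xx inv S by (simp add: subspace_diff subspace_scale)
  have "x \<bullet> r = 0" by (simp add: r_def inner_diff_right xx m_def)
  have rr: "r \<bullet> r = r \<bullet> (M *v x)"
    using \<open>x \<bullet> r = 0\<close> by (simp add: r_def inner_diff_right inner_commute)
  txt \<open>First variation of the form at the minimizer in the direction of the residual \<open>r\<close>.\<close>
  have "r \<bullet> r = 0"
  proof (rule quadratic_nonneg_linear_coeff_zero)
    fix t
    have "x + t *\<^sub>R r \<in> S"
      using xx \<open>r \<in> S\<close> S by (simp add: subspace_add subspace_scale)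
    from le[OF this] show "0 \<le> 2 * t * (r \<bullet> r) + t\<^sup>2 * (r \<bullet> (M *v r) - m * (r \<bullet> r))"
      unfolding symmetric_quadratic_form_expand[OF sym]
      using \<open>x \<bullet> r = 0\<close>
      by (simp add: rr[symmetric] m_def[symmetric] xx inner_add_left inner_add_right inner_commute
          algebra_simps power2_eq_square)
  qed
  then have "M *v x = m *\<^sub>R x" by (simp add: r_def)
  with x le show ?thesis
    by (intro that[of x m]) auto
qed

lemma symmetric_eigenvectors_orthogonal:
  fixes M :: "real^'n^'n"
  assumes "transpose M = M" "M *v x = a *\<^sub>R x" "M *v y = b *\<^sub>R y" "a \<noteq> b"
  shows "x \<bullet> y = 0"
  using symmetric_matrix_inner[OF assms(1), of x y] unfolding assms(2,3) using assms(4) by simp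

text \<open>Eigenvectors for different eigenvalues are nonzero and pairwise orthogonal, hence
  independent. Finiteness is what gives the \<open>Min\<close> in \<open>lambda_min\<close> its
  meaning.\<close>

lemma finite_eigenvalues:
  fixes M :: "real^'n^'n"
  assumes sym: "transpose M = M"
  shows "finite (eigenvalues M)"
proof -
  have "\<forall>l\<in>eigenvalues M. \<exists>v. v \<noteq> 0 \<and> M *v v = l *\<^sub>R v"
    by (simp add: eigenvalues_def)
  then obtain v where v: "\<And>l. l \<in> eigenvalues M \<Longrightarrow> v l \<noteq> 0 \<and> M *v v l = l *\<^sub>R v l"
    by metis
  have "inj_on v (eigenvalues M)"
    by (rule inj_onI) (metis v scaleR_right_imp_eq)
  moreover have "pairwise orthogonal (v ` eigenvalues M)"
    unfolding pairwise_image orthogonal_def pairwise_def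
    using symmetric_eigenvectors_orthogonal[OF sym] v by blast
  then have "finite (v ` eigenvalues M)"
    by (rule independent_imp_finite[OF pairwise_orthogonal_independent]) (metis imageE v)
  ultimately show ?thesis
    using finite_imageD by blast
qed

lemma lambda_min_le_form:
  fixes M :: "real^'n^'n"
  assumes "transpose M = M"
  shows "lambda_min M * (y \<bullet> y) \<le> y \<bullet> (M *v y)"
proof -
  have "(UNIV :: (real^'n) set) \<noteq> {0}"
    by (metis UNIV_I singletonD vec_eq_iff zero_index one_index zero_neq_one)
  then obtain x m where x: "norm x = 1" "M *v x = m *\<^sub>R x"
    and le: "\<And>y. y \<in> UNIV \<Longrightarrow> m * (y \<bullet> y) \<le> y \<bullet> (M *v y)"
    by (rule rayleigh_minimizer[OF assms subspace_UNIV _ UNIV_I]) (rule that; assumption)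
  then have "m \<in> eigenvalues M"
    unfolding eigenvalues_def using norm_zero by (metis (mono_tags, lifting) mem_Collect_eq zero_neq_one)
  then have "lambda_min M \<le> m"
    unfolding lambda_min_def using finite_eigenvalues[OF assms] by simp
  then show ?thesis
    using le[of y] by (meson UNIV_I inner_ge_zero mult_right_mono order_trans)
qed

lemma lambda_min_eigenvector:
  fixes M :: "real^'n^'n"
  assumes "transpose M = M"
  obtains x where "norm x = 1" "M *v x = lambda_min M *\<^sub>R x"
proof -
  have "(UNIV :: (real^'n) set) \<noteq> {0}"
    by (metis UNIV_I singletonD vec_eq_iff zero_index one_index zero_neq_one)
  then obtain x m where x: "norm x = 1" "M *v x = m *\<^sub>R x"
    using rayleigh_minimizer[OF assms subspace_UNIV] by blast
  then have "m \<in> eigenvalues M"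
    unfolding eigenvalues_def using norm_zero by (metis (mono_tags, lifting) mem_Collect_eq zero_neq_one)
  then have "lambda_min M \<in> eigenvalues M"
    unfolding lambda_min_def using finite_eigenvalues[OF assms] by (intro Min_in) auto
  then obtain v where v: "v \<noteq> 0" "M *v v = lambda_min M *\<^sub>R v"
    unfolding eigenvalues_def by blast
  show ?thesis
    by (rule that[of "(1 / norm v) *\<^sub>R v"]) (use v in \<open>simp_all add: matrix_vector_mult_scaleR\<close>)
qed

lemma lambda_min_scaleR_mat_1:
  "lambda_min (c *\<^sub>R mat 1 :: real^'n^'n) = c"
proof -
  have "transpose (c *\<^sub>R mat 1 :: real^'n^'n) = c *\<^sub>R mat 1"
    by (simp add: transpose_scalar)
  then obtain x :: "real^'n" where "norm x = 1"
    "(c *\<^sub>R mat 1) *v x = lambda_min (c *\<^sub>R mat 1 :: real^'n^'n) *\<^sub>R x"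
    using lambda_min_eigenvector by blast
  then show ?thesis
    by (metis matrix_vector_mul_lid norm_zero scaleR_matrix_vector_assoc scaleR_right_imp_eq zero_neq_one)
qed

lemma trace_eq_sum_axis:
  fixes M :: "real^'n^'n"
  shows "trace M = (\<Sum>i\<in>UNIV. axis i 1 \<bullet> (M *v axis i 1))"
  unfolding trace_def
  by (intro sum.cong refl) (simp add: matrix_vector_mult_basis inner_axis' column_def)

lemma lambda_min_le_trace:
  fixes M :: "real^'n^'n"
  assumes "transpose M = M"
  shows "real CARD('n) * lambda_min M \<le> trace M"
proof -
  have "(\<Sum>i\<in>(UNIV::'n set). lambda_min M) \<le> trace M"
    unfolding trace_eq_sum_axis
    by (rule sum_mono) (use lambda_min_le_form[OF assms, of "axis _ 1"] in \<open>simp add: inner_axis_axis\<close>)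
  then show ?thesis by simp
qed

text \<open>Subtracting the least eigenvalue leaves a positive semidefinite N of trace zero, whose
  diagonal entries must all vanish. A vector where a nonnegative form vanishes is a minimizer, so N
  maps it to zero; for the basis vectors this kills every column.\<close>

lemma scalar_if_lambda_min_eq_trace:
  fixes M :: "real^'n^'n"
  assumes sym: "transpose M = M" and eq: "real CARD('n) * lambda_min M = trace M"
  shows "M = lambda_min M *\<^sub>R mat 1"
proof -
  define N where "N = M - lambda_min M *\<^sub>R mat 1"
  have Nv: "N *v y = M *v y - lambda_min M *\<^sub>R y" for y
    by (simp add: N_def matrix_vector_mult_diff_rdistrib scaleR_matrix_vector_assoc[symmetric])
  have symN: "transpose N = N"
    using sym by (simp add: N_def transpose_def vec_eq_iff mat_def)
  have nonneg: "0 \<le> y \<bullet> (N *v y)" for y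
    using lambda_min_le_form[OF sym, of y] by (simp add: Nv inner_diff_right)
  have "trace N = trace M - real CARD('n) * lambda_min M"
    unfolding N_def trace_sub by (simp add: trace_def mat_def)
  then have "(\<Sum>i\<in>(UNIV::'n set). axis i 1 \<bullet> (N *v axis i 1)) = 0"
    using eq trace_eq_sum_axis[of N] by simp
  then have diag: "axis i 1 \<bullet> (N *v axis i 1) = 0" for i :: 'n
    using nonneg by (subst (asm) sum_nonneg_eq_0_iff) auto
  have "z \<bullet> (N *v axis i 1) = 0" for z :: "real^'n" and i
  proof (rule quadratic_nonneg_linear_coeff_zero)
    fix t
    show "0 \<le> 2 * t * (z \<bullet> (N *v axis i 1)) + t\<^sup>2 * (z \<bullet> (N *v z))"
      using nonneg[of "axis i 1 + t *\<^sub>R z"]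
      unfolding symmetric_quadratic_form_expand[OF symN] diag by simp
  qed
  from this[of "axis _ 1"] have "N = 0"
    by (simp add: vec_eq_iff inner_axis' matrix_vector_mul_component inner_axis)
  then show ?thesis by (simp add: N_def)
qed

text \<open>Both forms are compared at a unit eigenvector of N for its least eigenvalue. The sum of
  the entries dominates the operator norm and is visibly continuous, so exchanging M and N yields
  continuity of \<open>lambda_min\<close>.\<close>

lemma lambda_min_diff_le:
  fixes M N :: "real^'n^'n"
  assumes "transpose M = M" "transpose N = N"
  shows "lambda_min M - lambda_min N \<le> (\<Sum>i\<in>UNIV. \<Sum>j\<in>UNIV. \<bar>(M - N) $ i $ j\<bar>)"
proof -
  obtain x where x: "norm x = 1" "N *v x = lambda_min N *\<^sub>R x"
    using lambda_min_eigenvector[OF assms(2)] .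
  have xx: "x \<bullet> x = 1" using x by (simp add: dot_square_norm)
  have "lambda_min M - lambda_min N \<le> x \<bullet> (M *v x) - x \<bullet> (N *v x)"
    using lambda_min_le_form[OF assms(1), of x] x xx by simp
  also have "\<dots> = x \<bullet> ((M - N) *v x)"
    by (simp add: matrix_vector_mult_diff_rdistrib inner_diff_right)
  also have "\<dots> \<le> norm ((M - N) *v x)"
    using norm_cauchy_schwarz[of x "(M - N) *v x"] x by simp
  also have "\<dots> \<le> onorm ((*v) (M - N))"
    using onorm[OF matrix_vector_mul_bounded_linear, of "M - N" x] x by simp
  also have "\<dots> \<le> (\<Sum>i\<in>UNIV. \<Sum>j\<in>UNIV. \<bar>(M - N) $ i $ j\<bar>)"
    by (rule onorm_le_matrix_component_sum)
  finally show ?thesis .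
qed

lemma continuous_on_lambda_min:
  fixes f :: "'a::topological_space \<Rightarrow> real^'n^'n"
  assumes cont: "continuous_on S f" and sym: "\<And>x. x \<in> S \<Longrightarrow> transpose (f x) = f x"
  shows "continuous_on S (\<lambda>x. lambda_min (f x))"
proof (subst continuous_on_def, intro ballI)
  fix x assume x: "x \<in> S"
  let ?d = "\<lambda>y. \<Sum>i\<in>UNIV. \<Sum>j\<in>UNIV. \<bar>(f y - f x) $ i $ j\<bar>"
  have "continuous_on S ?d"
    using cont by (intro continuous_intros)
  then have lim: "(?d \<longlongrightarrow> 0) (at x within S)"
    using x unfolding continuous_on_def by fastforce
  have bound: "norm (lambda_min (f y) - lambda_min (f x)) \<le> ?d y" if "y \<in> S" for y
  proof -
    have "(\<Sum>i\<in>UNIV. \<Sum>j\<in>UNIV. \<bar>(f x - f y) $ i $ j\<bar>) = ?d y"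
      by (simp add: abs_minus_commute)
    then show ?thesis
      using lambda_min_diff_le[of "f y" "f x"] lambda_min_diff_le[of "f x" "f y"] sym x that
      by (simp add: abs_le_iff)
  qed
  have "((\<lambda>y. lambda_min (f y) - lambda_min (f x)) \<longlongrightarrow> 0) (at x within S)"
    by (rule Lim_null_comparison[OF _ lim]) (use bound in \<open>auto simp: eventually_at_filter\<close>)
  then show "((\<lambda>x. lambda_min (f x)) \<longlongrightarrow> lambda_min (f x)) (at x within S)"
    by (rule LIM_zero_cancel)
qed

section \<open>The matrix exponential\<close>

lemma mat_pow_0: "mat_pow A 0 = mat 1"
  by (simp add: mat_pow_def)

lemma mat_pow_Suc: "mat_pow A (Suc k) = A ** mat_pow A k"
  by (simp add: mat_pow_def)

lemma mat_pow_commute: "mat_pow A k ** A = A ** mat_pow A k"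
  by (induction k) (simp_all add: mat_pow_0 mat_pow_Suc matrix_mul_assoc[symmetric])

lemma mat_pow_scaleR: "mat_pow (t *\<^sub>R A) k = t ^ k *\<^sub>R mat_pow A k"
  by (induction k)
    (simp_all add: mat_pow_0 mat_pow_Suc scalar_matrix_assoc[symmetric] matrix_scalar_ac)

lemma transpose_mat_pow: "transpose (mat_pow A k) = mat_pow (transpose A) k"
  by (induction k) (simp_all add: mat_pow_0 mat_pow_Suc matrix_transpose_mul mat_pow_commute)

lemma bounded_linear_matrix_mult_right:
  "bounded_linear (\<lambda>X. A ** X :: real^'n^'n)"
  unfolding linear_conv_bounded_linear[symmetric]
  by (rule linearI) (simp_all add: matrix_add_ldistrib matrix_scalar_ac scalar_matrix_assoc[symmetric])

lemma bounded_linear_matrix_mult_left: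
  "bounded_linear (\<lambda>X. X ** A :: real^'n^'n)"
  unfolding linear_conv_bounded_linear[symmetric]
  by (rule linearI) (simp_all add: matrix_matrix_mult_def vec_eq_iff sum.distrib sum_distrib_left distrib_right mult.assoc)

lemma bounded_linear_matrix_form:
  "bounded_linear (\<lambda>M. u \<bullet> (M *v v) :: real)" for u v :: "real^'n"
  unfolding linear_conv_bounded_linear[symmetric]
  by (rule linearI)
    (simp_all add: matrix_vector_mult_add_rdistrib inner_add_right scaleR_matrix_vector_assoc[symmetric])

lemma bounded_linear_transpose:
  "bounded_linear (transpose :: real^'n^'n \<Rightarrow> real^'n^'n)"
  unfolding linear_conv_bounded_linear[symmetric]
  by (rule linearI) (simp_all add: transpose_def vec_eq_iff)

text \<open>The factor t is pulled out of the matrix powers, which makes the exponential a power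
  series in t with fixed coefficients, ready for termwise differentiation.\<close>

lemma mat_exp_sums:
  fixes A :: "real^'n^'n"
  shows "(\<lambda>k. (t ^ k / fact k) *\<^sub>R mat_pow A k) sums mat_exp (t *\<^sub>R A)"
proof -
  \<comment> \<open>K bounds left multiplication by A. Iteration gives |A^k| <= K^k |Id|, hence a
    comparison with the series of exp(|t| K).\<close>
  obtain K where K: "K > 0" "\<And>X :: real^'n^'n. norm (A ** X) \<le> norm X * K"
    using bounded_linear.pos_bounded[OF bounded_linear_matrix_mult_right[of A]] by auto
  have bound: "norm (mat_pow A k) \<le> K ^ k * norm (mat 1 :: real^'n^'n)" for k
  proof (induction k)
    case (Suc k)
    have "norm (mat_pow A (Suc k)) \<le> norm (mat_pow A k) * K"
      by (simp add: mat_pow_Suc K)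
    also have "\<dots> \<le> K ^ k * norm (mat 1 :: real^'n^'n) * K"
      using Suc K by (intro mult_right_mono) auto
    finally show ?case by (simp add: mult_ac)
  qed (simp add: mat_pow_0)
  have "summable (\<lambda>k. (t ^ k / fact k) *\<^sub>R mat_pow A k)"
  proof (rule summable_comparison_test')
    show "summable (\<lambda>k. inverse (fact k) * (\<bar>t\<bar> * K) ^ k * norm (mat 1 :: real^'n^'n))"
      by (intro summable_mult2 summable_exp)
    fix k :: nat
    have "norm ((t ^ k / fact k) *\<^sub>R mat_pow A k) = \<bar>t\<bar> ^ k / fact k * norm (mat_pow A k)"
      by (simp add: power_abs)
    also have "\<dots> \<le> \<bar>t\<bar> ^ k / fact k * (K ^ k * norm (mat 1 :: real^'n^'n))"
      by (intro mult_left_mono bound) simp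
    finally show "norm ((t ^ k / fact k) *\<^sub>R mat_pow A k)
        \<le> inverse (fact k) * (\<bar>t\<bar> * K) ^ k * norm (mat 1 :: real^'n^'n)"
      by (simp add: field_simps power_mult_distrib)
  qed
  moreover have "mat_exp (t *\<^sub>R A) = (\<Sum>k. (t ^ k / fact k) *\<^sub>R mat_pow A k)"
    unfolding mat_exp_def mat_pow_scaleR by (simp add: divide_inverse mult.commute)
  ultimately show ?thesis by (simp add: summable_sums)
qed

lemma mat_exp_form_sums:
  fixes A :: "real^'n^'n"
  shows "(\<lambda>k. (u \<bullet> (mat_pow A k *v v) / fact k) * t ^ k) sums (u \<bullet> (mat_exp (t *\<^sub>R A) *v v))"
  using bounded_linear.sums[OF bounded_linear_matrix_form mat_exp_sums, of u t A v]
  by (simp add: scaleR_matrix_vector_assoc[symmetric] mult.commute)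

lemma mat_exp_zero: "mat_exp 0 = (mat 1 :: real^'n^'n)"
proof -
  have "(\<lambda>k. (0 ^ k / fact k) *\<^sub>R mat_pow (0 :: real^'n^'n) k) sums
          (\<Sum>k\<in>{0}. (0 ^ k / fact k) *\<^sub>R mat_pow 0 k)"
    by (rule sums_finite) auto
  then show ?thesis
    using mat_exp_sums[of 0 "0 :: real^'n^'n"] sums_unique2 by (fastforce simp: mat_pow_0)
qed

lemma mat_exp_commute: "A ** mat_exp (t *\<^sub>R A) = mat_exp (t *\<^sub>R A) ** (A :: real^'n^'n)"
proof -
  have "(\<lambda>k. A ** ((t ^ k / fact k) *\<^sub>R mat_pow A k)) sums (A ** mat_exp (t *\<^sub>R A))"
    by (rule bounded_linear.sums[OF bounded_linear_matrix_mult_right mat_exp_sums])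
  moreover have "(\<lambda>k. ((t ^ k / fact k) *\<^sub>R mat_pow A k) ** A) sums (mat_exp (t *\<^sub>R A) ** A)"
    by (rule bounded_linear.sums[OF bounded_linear_matrix_mult_left mat_exp_sums])
  moreover have "A ** (c *\<^sub>R mat_pow A k) = (c *\<^sub>R mat_pow A k) ** A" for c k
    by (simp add: matrix_scalar_ac scalar_matrix_assoc[symmetric] mat_pow_commute)
  ultimately show ?thesis
    using sums_unique2 by simp
qed

lemma transpose_mat_exp: "transpose (mat_exp (t *\<^sub>R A)) = mat_exp (t *\<^sub>R transpose (A :: real^'n^'n))"
proof -
  have "(\<lambda>k. (t ^ k / fact k) *\<^sub>R mat_pow (transpose A) k) sums transpose (mat_exp (t *\<^sub>R A))"
    using bounded_linear.sums[OF bounded_linear_transpose mat_exp_sums, of t A]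
    by (simp add: transpose_scalar transpose_mat_pow)
  then show ?thesis
    using mat_exp_sums sums_unique2 by blast
qed

lemma mat_exp_form_deriv:
  fixes A :: "real^'n^'n"
  shows "((\<lambda>t. u \<bullet> (mat_exp (t *\<^sub>R A) *v v)) has_field_derivative
           u \<bullet> (A *v (mat_exp (t *\<^sub>R A) *v v))) (at t)"
proof -
  define c where "c u k = u \<bullet> (mat_pow A k *v v) / fact k" for u k
  have c: "(\<lambda>k. c u k * t ^ k) sums (u \<bullet> (mat_exp (t *\<^sub>R A) *v v))" for u t
    unfolding c_def by (rule mat_exp_form_sums)
  \<comment> \<open>Termwise differentiation shifts A^k to A^{k+1}. Moving the extra A onto u leaves
    a series of the same kind, with \<open>transpose A *v u\<close> in place of u.\<close>
  have "diffs (c u) k = c (transpose A *v u) k" for k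
    by (simp add: diffs_def c_def mat_pow_Suc matrix_vector_mul_assoc[symmetric] dot_lmul_matrix
        del: of_nat_Suc)
  then have "(\<Sum>k. diffs (c u) k * t ^ k) = (\<Sum>k. c (transpose A *v u) k * t ^ k)"
    by simp
  also have "\<dots> = (transpose A *v u) \<bullet> (mat_exp (t *\<^sub>R A) *v v)"
    by (rule sums_unique[OF c, symmetric])
  also have "\<dots> = u \<bullet> (A *v (mat_exp (t *\<^sub>R A) *v v))"
    by (simp add: dot_lmul_matrix)
  finally have "(\<Sum>k. diffs (c u) k * t ^ k) = u \<bullet> (A *v (mat_exp (t *\<^sub>R A) *v v))" .
  moreover have "((\<lambda>t. \<Sum>k. c u k * t ^ k) has_field_derivative (\<Sum>k. diffs (c u) k * t ^ k)) (at t)"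
    by (rule termdiffs_strong_converges_everywhere[OF sums_summable[OF c]])
  moreover have "(\<lambda>t. \<Sum>k. c u k * t ^ k) = (\<lambda>t. u \<bullet> (mat_exp (t *\<^sub>R A) *v v))"
    by (intro ext sums_unique[OF c, symmetric])
  ultimately show ?thesis by simp
qed

lemma mat_exp_vector_deriv:
  fixes A :: "real^'n^'n"
  shows "((\<lambda>t. mat_exp (t *\<^sub>R A) *v v) has_vector_derivative A *v (mat_exp (t *\<^sub>R A) *v v)) (at t)"
  unfolding has_vector_derivative_def
proof (subst has_derivative_componentwise_within, intro ballI)
  fix i :: "real^'n"
  show "((\<lambda>t. (mat_exp (t *\<^sub>R A) *v v) \<bullet> i) has_derivative
          (\<lambda>s. (s *\<^sub>R (A *v (mat_exp (t *\<^sub>R A) *v v))) \<bullet> i)) (at t)"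
    unfolding inner_commute[of _ i]
    by (rule has_derivative_eq_rhs[OF mat_exp_form_deriv[unfolded has_field_derivative_def]]) auto
qed

lemma continuous_on_mat_exp_vector:
  fixes A :: "real^'n^'n"
  shows "continuous_on S (\<lambda>t. mat_exp (t *\<^sub>R A) *v v)"
  by (intro continuous_at_imp_continuous_on ballI has_vector_derivative_continuous[OF mat_exp_vector_deriv])

lemma continuous_on_mat_exp:
  fixes A :: "real^'n^'n"
  shows "continuous_on S (\<lambda>t. mat_exp (t *\<^sub>R A))"
proof -
  have "continuous_on S (\<lambda>t. mat_exp (t *\<^sub>R A) $ i $ j)" for i j
    using continuous_on_component[OF continuous_on_mat_exp_vector, of S A "axis j 1" i]
    by (simp add: matrix_vector_mult_basis column_def)
  then have "continuous_on S (\<lambda>t. \<chi> i j. mat_exp (t *\<^sub>R A) $ i $ j)"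
    by (intro continuous_on_vec_lambda)
  then show ?thesis by simp
qed

text \<open>By skewness the derivative of the inner product along the two flows vanishes, so it
  keeps its value at t = 0.\<close>

lemma mat_exp_skew_inner:
  fixes A :: "real^'n^'n"
  assumes "transpose A = - A"
  shows "(mat_exp (t *\<^sub>R A) *v x) \<bullet> (mat_exp (t *\<^sub>R A) *v y) = x \<bullet> y"
proof -
  let ?f = "\<lambda>t. (mat_exp (t *\<^sub>R A) *v x) \<bullet> (mat_exp (t *\<^sub>R A) *v y)"
  have "(?f has_field_derivative 0) (at t)" for t
    using bounded_bilinear.has_vector_derivative[OF bounded_bilinear_inner
        mat_exp_vector_deriv[of A x t] mat_exp_vector_deriv[of A y t]]
    by (simp add: has_real_derivative_iff_has_vector_derivative skew_matrix_inner[OF assms])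
  then have "?f t = ?f 0"
    using DERIV_isconst_all by blast
  then show ?thesis by (simp add: mat_exp_zero)
qed

lemma mat_exp_skew_orthogonal:
  fixes A :: "real^'n^'n"
  assumes "transpose A = - A"
  shows "transpose (mat_exp (t *\<^sub>R A)) ** mat_exp (t *\<^sub>R A) = mat 1"
proof -
  let ?E = "mat_exp (t *\<^sub>R A)"
  have "(transpose ?E ** ?E) *v y = y" for y
  proof (rule vector_eq_ldot[THEN iffD1], intro allI)
    fix x
    show "x \<bullet> ((transpose ?E ** ?E) *v y) = x \<bullet> y"
      using mat_exp_skew_inner[OF assms, of t x y]
      by (metis dot_lmul_matrix matrix_vector_mul_assoc transpose_matrix_vector transpose_transpose)
  qed
  then show ?thesis by (simp add: matrix_eq)
qed

text \<open>Since A commutes with e^{tA}, the velocity A e^{tA} v = e^{tA} A v is zero. This is what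
  excludes \<sigma> = -1 when the kernel is nontrivial.\<close>

lemma mat_exp_fixes_kernel:
  fixes A :: "real^'n^'n"
  assumes "A *v v = 0"
  shows "mat_exp (t *\<^sub>R A) *v v = v"
proof (rule vector_eq_ldot[THEN iffD1], intro allI)
  fix u
  have "A *v (mat_exp (t *\<^sub>R A) *v v) = 0" for t
    by (simp add: matrix_vector_mul_assoc mat_exp_commute) (simp add: assms flip: matrix_vector_mul_assoc)
  then have "((\<lambda>t. u \<bullet> (mat_exp (t *\<^sub>R A) *v v)) has_field_derivative 0) (at t)" for t
    using mat_exp_form_deriv[of u A v t] by simp
  then have "u \<bullet> (mat_exp (t *\<^sub>R A) *v v) = u \<bullet> (mat_exp (0 *\<^sub>R A) *v v)"
    using DERIV_isconst_all[of "\<lambda>t. u \<bullet> (mat_exp (t *\<^sub>R A) *v v)"] by blast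
  then show "u \<bullet> (mat_exp (t *\<^sub>R A) *v v) = u \<bullet> v"
    by (simp add: mat_exp_zero inner_commute)
qed

section \<open>Krylov spaces and Gramians\<close>

text \<open>Takes the place of the Cayley-Hamilton theorem: once some A^m b with m <= n depends on
  the earlier powers, their span is invariant and contains all later powers.\<close>

lemma mat_pow_vec_mem_krylov_span:
  fixes A :: "real^'n^'n"
  shows "mat_pow A k *v b \<in> span ((\<lambda>k. mat_pow A k *v b) ` {..<CARD('n)})"
proof -
  define p where "p k = mat_pow A k *v b" for k
  have p_Suc: "A *v p k = p (Suc k)" for k
    by (simp add: p_def mat_pow_Suc matrix_vector_mul_assoc)
  have "\<exists>m\<le>CARD('n). p m \<in> span (p ` {..<m})"
  proof (rule ccontr)
    txt \<open>Otherwise each new power raises the dimension of the span, up to \<open>n + 1\<close>.\<close>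
    assume none: "\<not> ?thesis"
    have "dim (p ` {..<m}) = m" if "m \<le> Suc CARD('n)" for m
      using that
    proof (induction m)
      case (Suc m)
      then have "p m \<notin> span (p ` {..<m})" using none by auto
      then show ?case using Suc by (simp add: lessThan_Suc dim_insert)
    qed simp
    from this[of "Suc CARD('n)"] show False
      using dim_subset_UNIV[of "p ` {..<Suc CARD('n)}"] by simp
  qed
  then obtain m where m: "m \<le> CARD('n)" "p m \<in> span (p ` {..<m})" by blast
  have step: "A *v x \<in> span (p ` {..<m})" if "x \<in> span (p ` {..<m})" for x
  proof -
    have "A *v x \<in> span ((*v) A ` p ` {..<m})"
      using that by (simp add: linear_span_image)
    moreover have "(*v) A ` p ` {..<m} \<subseteq> span (p ` {..<m})"
    proof clarsimp
      \<comment> \<open>Only the last generator, with Suc k = m, is moved out of the list;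
        \<open>m(2)\<close> puts its image back into the span.\<close>
      fix k assume "k < m"
      then show "A *v p k \<in> span (p ` {..<m})"
        using m(2) by (cases "Suc k = m") (auto simp: p_Suc intro: span_base)
    qed
    ultimately show ?thesis
      using span_minimal[OF _ subspace_span] by blast
  qed
  have "p k \<in> span (p ` {..<m})"
  proof (induction k)
    case 0
    \<comment> \<open>For m = 0 the list of generators is empty, and \<open>m(2)\<close> itself is
      the claim.\<close>
    show ?case using m(2) by (cases "m = 0") (auto intro: span_base)
  next
    case (Suc k)
    then show ?case using step p_Suc by metis
  qed
  moreover have "span (p ` {..<m}) \<subseteq> span (p ` {..<CARD('n)})"
    using m(1) by (intro span_mono) auto
  ultimately show ?thesis unfolding p_def by blast
qed

text \<open>Invariance of spans and orthogonality to all powers are handled more easily without the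
  bound k < n.\<close>

lemma cyclic_iff_span_all_powers:
  fixes A :: "real^'n^'n"
  shows "cyclic A \<longleftrightarrow> (\<exists>b. span (range (\<lambda>k. mat_pow A k *v b)) = UNIV)"
proof -
  have "span (range (\<lambda>k. mat_pow A k *v b)) = span ((\<lambda>k. mat_pow A k *v b) ` {..<CARD('n)})" for b
    by (intro antisym span_minimal subspace_span span_mono)
      (use mat_pow_vec_mem_krylov_span in auto)
  then show ?thesis by (simp add: cyclic_def)
qed

lemma weighted_gramian_integrand_continuous:
  fixes A :: "real^'n^'n"
  shows "continuous_on S (\<lambda>t. mat_exp (t *\<^sub>R A) ** X ** mat_exp (t *\<^sub>R transpose A))"
  unfolding matrix_matrix_mult_def
  by (intro continuous_intros continuous_on_mat_exp)

text \<open>Bounded linear maps pass through the integral; transposition, the trace and the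
  functionals M |-> u . M v are the instances used.\<close>

lemma weighted_gramian_linear_image:
  fixes A :: "real^'n^'n"
  assumes "bounded_linear h"
  shows "h (weighted_gramian A T X) =
           integral {0..T} (\<lambda>t. h (mat_exp (t *\<^sub>R A) ** X ** mat_exp (t *\<^sub>R transpose A)))"
  unfolding weighted_gramian_def
  by (subst integral_linear[OF integrable_continuous_interval[OF weighted_gramian_integrand_continuous] assms,
        symmetric]) (simp add: o_def)

lemma transpose_weighted_gramian:
  fixes A :: "real^'n^'n"
  assumes "transpose X = X"
  shows "transpose (weighted_gramian A T X) = weighted_gramian A T X"
  unfolding weighted_gramian_linear_image[OF bounded_linear_transpose]
  by (simp add: matrix_transpose_mul transpose_mat_exp assms matrix_mul_assoc weighted_gramian_def)

lemma linear_weighted_gramian: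
  fixes A :: "real^'n^'n"
  shows "linear (weighted_gramian A T)"
proof (rule linearI)
  fix X Y :: "real^'n^'n" and c :: real
  have "P ** (X + Y) ** Q = P ** X ** Q + P ** Y ** Q" for P Q :: "real^'n^'n"
    unfolding matrix_add_ldistrib
    by (rule linear_add[OF bounded_linear.linear[OF bounded_linear_matrix_mult_left]])
  then show "weighted_gramian A T (X + Y) = weighted_gramian A T X + weighted_gramian A T Y"
    unfolding weighted_gramian_def
    by (simp add: integral_add integrable_continuous_interval[OF weighted_gramian_integrand_continuous])
  show "weighted_gramian A T (c *\<^sub>R X) = c *\<^sub>R weighted_gramian A T X"
    unfolding weighted_gramian_def
    by (simp add: matrix_scalar_ac scalar_matrix_assoc[symmetric])
qed

lemma trace_weighted_gramian:
  fixes A :: "real^'n^'n"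
  assumes skew: "transpose A = - A" and T: "0 \<le> T"
  shows "trace (weighted_gramian A T X) = T * trace X"
proof -
  have "bounded_linear (trace :: real^'n^'n \<Rightarrow> real)"
    unfolding linear_conv_bounded_linear[symmetric]
    by (rule linearI) (simp_all add: trace_def sum.distrib sum_distrib_left)
  moreover have "trace (mat_exp (t *\<^sub>R A) ** X ** mat_exp (t *\<^sub>R transpose A)) = trace X" for t
  proof -
    have "trace (mat_exp (t *\<^sub>R A) ** X ** mat_exp (t *\<^sub>R transpose A)) =
          trace (transpose (mat_exp (t *\<^sub>R A)) ** (mat_exp (t *\<^sub>R A) ** X))"
      unfolding transpose_mat_exp by (rule trace_mul_sym)
    then show ?thesis
      by (simp add: matrix_mul_assoc mat_exp_skew_orthogonal[OF skew])
  qed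
  ultimately show ?thesis
    using T by (subst weighted_gramian_linear_image) simp_all
qed

lemma weighted_gramian_scaleR_mat_1:
  fixes A :: "real^'n^'n"
  assumes skew: "transpose A = - A" and "0 \<le> T"
  shows "weighted_gramian A T (c *\<^sub>R mat 1) = (T * c) *\<^sub>R mat 1"
proof -
  have "mat_exp (t *\<^sub>R A) ** mat_exp (t *\<^sub>R transpose A) = mat 1" for t
    using mat_exp_skew_orthogonal[OF skew, of t]
    by (simp add: matrix_left_right_inverse transpose_mat_exp)
  then show ?thesis
    using assms(2)
    by (simp add: weighted_gramian_def matrix_scalar_ac scalar_matrix_assoc[symmetric])
qed

section \<open>Rank-one Gramians as scalar integrals\<close>

lemma outer_product_vec:
  fixes b :: "real^'n"
  shows "((columnvector b :: real^1^'n) ** (rowvector b :: real^'n^1)) *v z = (b \<bullet> z) *\<^sub>R b"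
  by (simp add: vec_eq_iff matrix_vector_mult_def matrix_matrix_mult_def columnvector_def
      rowvector_def inner_vec_def sum_distrib_left mult.assoc mult.commute mult.left_commute)

lemma transpose_outer_product:
  fixes b :: "real^'n"
  shows "transpose ((columnvector b :: real^1^'n) ** (rowvector b :: real^'n^1)) =
    (columnvector b :: real^1^'n) ** (rowvector b :: real^'n^1)"
  by (simp add: matrix_transpose_mul transpose_columnvector transpose_rowvector)

lemma trace_outer_product:
  fixes b :: "real^'n"
  shows "trace ((columnvector b :: real^1^'n) ** (rowvector b :: real^'n^1)) = b \<bullet> b"
  by (simp add: trace_def matrix_matrix_mult_def columnvector_def rowvector_def inner_vec_def)

lemma transpose_gramian: "transpose (gramian A T b) = gramian A T b"
  unfolding gramian_def by (intro transpose_weighted_gramian transpose_outer_product)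

text \<open>The integrand is the outer product of e^{tA} b with itself, so testing with x and y
  splits it into two scalar factors. The Lyapunov identity and the values on the modes are computed
  in this form.\<close>

lemma gramian_form:
  fixes A :: "real^'n^'n"
  shows "x \<bullet> (gramian A T b *v y) =
    integral {0..T} (\<lambda>t. (x \<bullet> (mat_exp (t *\<^sub>R A) *v b)) * (y \<bullet> (mat_exp (t *\<^sub>R A) *v b)))"
proof -
  let ?B = "(columnvector b :: real^1^'n) ** (rowvector b :: real^'n^1)"
  have "x \<bullet> ((E ** ?B ** transpose E) *v y) = (x \<bullet> (E *v b)) * (y \<bullet> (E *v b))"
    for E :: "real^'n^'n"
  proof -
    have "b \<bullet> (transpose E *v y) = y \<bullet> (E *v b)"
      by (metis dot_lmul_matrix inner_commute transpose_matrix_vector)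
    moreover have "(E ** ?B ** transpose E) *v y = E *v (?B *v (transpose E *v y))"
      by (simp only: matrix_vector_mul_assoc matrix_mul_assoc)
    ultimately show ?thesis
      by (simp only: outer_product_vec matrix_vector_mult_scaleR inner_scaleR_right mult.commute)
  qed
  then show ?thesis
    unfolding gramian_def weighted_gramian_linear_image[OF bounded_linear_matrix_form]
    by (simp flip: transpose_mat_exp)
qed

lemma gramian_integrand_integrable:
  fixes A :: "real^'n^'n"
  shows "(\<lambda>t. (x \<bullet> (mat_exp (t *\<^sub>R A) *v b)) * (y \<bullet> (mat_exp (t *\<^sub>R A) *v b))) integrable_on {0..T}"
  by (intro integrable_continuous_interval continuous_intros continuous_on_mat_exp_vector)

lemma continuous_on_gramian:
  "continuous_on S (\<lambda>b. gramian A T b)"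
proof -
  have "continuous_on UNIV (weighted_gramian A T)"
    using linear_weighted_gramian linear_continuous_on linear_conv_bounded_linear by blast
  moreover have "continuous_on S (\<lambda>b::real^'a. (columnvector b :: real^1^'a) ** (rowvector b :: real^'a^1))"
    unfolding matrix_matrix_mult_def columnvector_def rowvector_def
    by (simp, intro continuous_intros)
  ultimately show ?thesis
    unfolding gramian_def by (rule continuous_on_compose2) auto
qed

section \<open>Attainment of the maxima and the trace bound\<close>

lemma gamma_1_attained:
  fixes A :: "real^'n^'n"
  obtains b where "norm b = 1" "lambda_min (gramian A T b) = gamma_1 A T"
    "\<And>c. norm c = 1 \<Longrightarrow> lambda_min (gramian A T c) \<le> gamma_1 A T"
proof -
  \<comment> \<open>\<open>GREATEST\<close> determines \<open>gamma_1\<close> only if a greatest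
    value is attained, which compactness of the sphere provides.\<close>
  have "continuous_on (sphere 0 1) (\<lambda>b. lambda_min (gramian A T b))"
    by (intro continuous_on_lambda_min continuous_on_gramian transpose_gramian)
  \<comment> \<open>\<open>undefined\<close> is an arbitrary index: any basis vector shows that the
    sphere is nonempty.\<close>
  moreover have "axis undefined 1 \<in> sphere (0::real^'n) 1" by simp
  ultimately obtain b where b: "norm b = 1"
    "\<And>c. norm c = 1 \<Longrightarrow> lambda_min (gramian A T c) \<le> lambda_min (gramian A T b)"
    using continuous_attains_sup[OF compact_sphere, of 0 1 "\<lambda>b. lambda_min (gramian A T b)"]
    by (metis dist_0_norm empty_iff mem_sphere)
  then have "gamma_1 A T = lambda_min (gramian A T b)"
    unfolding gamma_1_def by (intro Greatest_equality) auto
  with b show ?thesis by (intro that[of b]) auto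
qed

lemma gamma_rel_skew:
  fixes A :: "real^'n^'n"
  assumes skew: "transpose A = - A" and T: "0 \<le> T"
  shows "gamma_rel A T = T / real CARD('n)"
  unfolding gamma_rel_def
proof (rule Greatest_equality)
  let ?X = "(1 / real CARD('n)) *\<^sub>R mat 1 :: real^'n^'n"
  have "pos_semidef ?X"
    by (simp add: pos_semidef_def transpose_scalar scaleR_matrix_vector_assoc[symmetric])
  moreover have "trace ?X = 1"
    by (simp add: trace_def mat_def)
  moreover have "T / real CARD('n) = lambda_min (weighted_gramian A T ?X)"
    by (simp add: weighted_gramian_scaleR_mat_1[OF assms] lambda_min_scaleR_mat_1)
  ultimately show "\<exists>X :: real^'n^'n. pos_semidef X \<and> trace X = 1 \<and> T / real CARD('n) = lambda_min (weighted_gramian A T X)"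
    by blast
next
  fix r assume "\<exists>X. pos_semidef X \<and> trace X = 1 \<and> r = lambda_min (weighted_gramian A T X)"
  then obtain X where X: "pos_semidef X" "trace X = 1" "r = lambda_min (weighted_gramian A T X)"
    by blast
  then have "real CARD('n) * r \<le> T"
    using lambda_min_le_trace[OF transpose_weighted_gramian, of X A T] trace_weighted_gramian[OF assms, of X]
    by (simp add: pos_semidef_def)
  then show "r \<le> T / real CARD('n)"
    by (simp add: field_simps)
qed

lemma lambda_min_gramian_le:
  fixes A :: "real^'n^'n"
  assumes "transpose A = - A" "0 \<le> T" "norm b = 1"
  shows "lambda_min (gramian A T b) \<le> T / real CARD('n)"
proof -
  have "trace (gramian A T b) = T"
    using assms by (simp add: gramian_def trace_weighted_gramian trace_outer_product dot_square_norm)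
  then show ?thesis
    using lambda_min_le_trace[OF transpose_gramian, of A T b] by (simp add: field_simps)
qed

lemma gramian_eq_if_lambda_min_maximal:
  fixes A :: "real^'n^'n"
  assumes "transpose A = - A" "0 \<le> T" "norm b = 1" "lambda_min (gramian A T b) = T / real CARD('n)"
  shows "gramian A T b = (T / real CARD('n)) *\<^sub>R mat 1"
proof -
  have "trace (gramian A T b) = T"
    using assms by (simp add: gramian_def trace_weighted_gramian trace_outer_product dot_square_norm)
  then show ?thesis
    using scalar_if_lambda_min_eq_trace[OF transpose_gramian, of A T b] assms by simp
qed

text \<open>The two sides have traces T |b|^2 and T. The weight conditions do not mention the norm
  of b; it is recovered here instead of by adding up the dimensions of the modes.\<close>

lemma norm_eq_1_if_gramian_scalar:
  fixes A :: "real^'n^'n"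
  assumes "transpose A = - A" "0 < T" "gramian A T b = (T / real CARD('n)) *\<^sub>R mat 1"
  shows "norm b = 1"
proof -
  have "T * (b \<bullet> b) = trace ((T / real CARD('n)) *\<^sub>R mat 1 :: real^'n^'n)"
    using assms by (simp flip: assms(3) add: gramian_def trace_weighted_gramian trace_outer_product)
  also have "\<dots> = T" by (simp add: trace_def mat_def)
  finally show ?thesis using assms(2) by (simp add: norm_eq_sqrt_inner)
qed

text \<open>The commutator identity tested on x and y: skewness moves A onto the test vectors with a
  minus sign, so the integrand on the left is minus the derivative of (x . e^{tA} b)(y . e^{tA} b),
  and only the endpoints remain.\<close>

lemma gramian_lyapunov:
  fixes A :: "real^'n^'n"
  assumes skew: "transpose A = - A" and T: "0 \<le> T"
  shows "(A *v x) \<bullet> (gramian A T b *v y) + x \<bullet> (gramian A T b *v (A *v y)) =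
    (x \<bullet> b) * (y \<bullet> b) - (x \<bullet> (mat_exp (T *\<^sub>R A) *v b)) * (y \<bullet> (mat_exp (T *\<^sub>R A) *v b))"
proof -
  let ?e = "\<lambda>t. mat_exp (t *\<^sub>R A) *v b"
  have "((\<lambda>t. (x \<bullet> ?e t) * (y \<bullet> ?e t)) has_vector_derivative
          - (((A *v x) \<bullet> ?e t) * (y \<bullet> ?e t) + (x \<bullet> ?e t) * ((A *v y) \<bullet> ?e t))) (at t within {0..T})" for t
    by (rule has_vector_derivative_at_within)
      (use DERIV_mult[OF mat_exp_form_deriv[of x A b t] mat_exp_form_deriv[of y A b t]] in
        \<open>simp add: has_real_derivative_iff_has_vector_derivative skew_matrix_inner[OF skew] algebra_simps\<close>)
  then have "((\<lambda>t. - (((A *v x) \<bullet> ?e t) * (y \<bullet> ?e t) + (x \<bullet> ?e t) * ((A *v y) \<bullet> ?e t))) has_integral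
      (x \<bullet> ?e T) * (y \<bullet> ?e T) - (x \<bullet> ?e 0) * (y \<bullet> ?e 0)) {0..T}"
    by (intro fundamental_theorem_of_calculus T)
  from integral_unique[OF this] show ?thesis
    unfolding gramian_form integral_neg
    by (simp add: integral_add gramian_integrand_integrable mat_exp_zero del: minus_add_distrib)
qed

lemma span_powers_if_gramian_scalar:
  fixes A :: "real^'n^'n"
  assumes "gramian A T b = c *\<^sub>R mat 1" "c > 0"
  shows "span (range (\<lambda>k. mat_pow A k *v b)) = UNIV"
proof (rule ccontr)
  assume "\<not> ?thesis"
  then have "dim (range (\<lambda>k. mat_pow A k *v b)) < DIM(real^'n)"
    by (metis dim_eq_full dim_subset_UNIV le_neq_implies_less)
  then obtain v where v: "v \<noteq> 0" "\<And>y. y \<in> span (range (\<lambda>k. mat_pow A k *v b)) \<Longrightarrow> orthogonal v y"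
    using orthogonal_to_subspace_exists by blast
  then have "v \<bullet> (mat_pow A k *v b) = 0" for k
    by (auto simp: orthogonal_def intro: span_base)
  then have "v \<bullet> (mat_exp (t *\<^sub>R A) *v b) = 0" for t
    using mat_exp_form_sums[of v A b t] by (auto dest: sums_unique2[OF sums_zero])
  then have "v \<bullet> (gramian A T b *v v) = 0"
    by (simp add: gramian_form)
  then show False
    using v assms by (simp add: scaleR_matrix_vector_assoc[symmetric])
qed

section \<open>Modal decompositions\<close>

lemma matrix_vector_mult_minus_right:
  fixes A :: "real^'n^'m"
  shows "A *v (- x) = - (A *v x)"
  by (rule linear_neg[OF matrix_vector_mul_linear])

text \<open>Two candidates differ by an element of S that is orthogonal to itself, so exhibiting one
  determines the \<open>THE\<close> in \<open>orth_proj\<close>.\<close>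

lemma orth_proj_eq:
  assumes "subspace S" "y \<in> S" "\<And>z. z \<in> S \<Longrightarrow> orthogonal (x - y) z"
  shows "orth_proj S x = y"
  unfolding orth_proj_def
proof (rule the_equality)
  show "y \<in> S \<and> (\<forall>z\<in>S. orthogonal (x - y) z)" using assms by blast
next
  fix y' assume y': "y' \<in> S \<and> (\<forall>z\<in>S. orthogonal (x - y') z)"
  then have "y' - y \<in> S" using assms by (simp add: subspace_diff)
  then have "(x - y) \<bullet> (y' - y) = 0" "(x - y') \<bullet> (y' - y) = 0"
    using assms(3) y' by (auto simp: orthogonal_def)
  then have "(y' - y) \<bullet> (y' - y) = 0" by (simp add: inner_diff_left)
  then show "y' = y" by simp
qed

lemma orth_proj_line_norm:
  assumes "norm v = 1"
  shows "(norm (orth_proj (span {v}) b))\<^sup>2 = (v \<bullet> b)\<^sup>2"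
proof -
  have "orth_proj (span {v}) b = (v \<bullet> b) *\<^sub>R v"
  proof (rule orth_proj_eq)
    show "(v \<bullet> b) *\<^sub>R v \<in> span {v}"
      by (intro span_scale span_base) simp
    show "orthogonal (b - (v \<bullet> b) *\<^sub>R v) z" if "z \<in> span {v}" for z
      using that assms
      by (auto simp: span_singleton orthogonal_def inner_diff_left inner_commute[of b v] dot_square_norm)
  qed simp
  then show ?thesis using assms by (simp add: power_mult_distrib)
qed

lemma span_pairE:
  fixes u v :: "'a::real_vector"
  assumes "x \<in> span {u, v}"
  obtains a c where "x = a *\<^sub>R u + c *\<^sub>R v"
  using assms by (auto simp: span_insert span_singleton algebra_simps)

lemma orth_proj_plane_norm:
  assumes "u \<bullet> u = 1" "v \<bullet> v = 1" "u \<bullet> v = 0"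
  shows "(norm (orth_proj (span {u, v}) b))\<^sup>2 = (u \<bullet> b)\<^sup>2 + (v \<bullet> b)\<^sup>2"
proof -
  have "orth_proj (span {u, v}) b = (u \<bullet> b) *\<^sub>R u + (v \<bullet> b) *\<^sub>R v"
  proof (rule orth_proj_eq)
    show "(u \<bullet> b) *\<^sub>R u + (v \<bullet> b) *\<^sub>R v \<in> span {u, v}"
      by (intro span_add span_scale span_base) auto
    fix z assume "z \<in> span {u, v}"
    then obtain a c where "z = a *\<^sub>R u + c *\<^sub>R v" by (rule span_pairE)
    then show "orthogonal (b - ((u \<bullet> b) *\<^sub>R u + (v \<bullet> b) *\<^sub>R v)) z"
      using assms inner_commute[of v u] inner_commute[of b u] inner_commute[of b v]
      by (simp add: orthogonal_def inner_diff_left inner_add_left inner_add_right)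
  qed simp
  then show ?thesis
    using assms inner_commute[of v u] unfolding power2_norm_eq_inner
    by (simp add: inner_add_left inner_add_right power2_eq_square)
qed

lemma acts_as_rotation_iff:
  fixes A :: "real^'n^'n"
  shows "acts_as_rotation A S w \<longleftrightarrow>
    (\<exists>u v. u \<bullet> u = 1 \<and> v \<bullet> v = 1 \<and> u \<bullet> v = 0 \<and> span {u, v} = S \<and> A *v u = w *\<^sub>R v \<and> A *v v = - w *\<^sub>R u)"
    (is "_ \<longleftrightarrow> ?rhs")
proof
  assume "acts_as_rotation A S w"
  then obtain u :: "2 \<Rightarrow> real^'n" where u: "\<forall>i j. u i \<bullet> u j = (if i = j then 1 else 0)"
    "span (range u) = S" "\<forall>j. A *v u j = (\<Sum>i\<in>UNIV. (w *\<^sub>R J) $ i $ j *\<^sub>R u i)"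
    unfolding acts_as_rotation_def by blast
  have "u 1 \<bullet> u 1 = 1" "u 2 \<bullet> u 2 = 1" "u 1 \<bullet> u 2 = 0"
    using u(1) by (auto simp: forall_2)
  moreover have "span {u 1, u 2} = S"
    using u(2) by (simp add: UNIV_2)
  moreover have "A *v u 1 = w *\<^sub>R u 2" "A *v u 2 = - w *\<^sub>R u 1"
    using u(3) by (auto simp: J_def sum_2)
  ultimately show ?rhs by blast
next
  assume ?rhs
  then obtain u v where uv: "u \<bullet> u = 1" "v \<bullet> v = 1" "u \<bullet> v = 0" "span {u, v} = S"
    "A *v u = w *\<^sub>R v" "A *v v = - w *\<^sub>R u"
    by blast
  let ?u = "\<lambda>i::2. if i = 1 then u else v"
  have "\<forall>i j. ?u i \<bullet> ?u j = (if i = j then 1 else 0)"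
    using uv by (simp add: forall_2 inner_commute)
  moreover have "span (range ?u) = S"
    using uv(4) by (simp add: UNIV_2 insert_commute)
  moreover have "\<forall>j. A *v ?u j = (\<Sum>i\<in>UNIV. (w *\<^sub>R J) $ i $ j *\<^sub>R ?u i)"
    using uv by (simp add: forall_2 J_def sum_2)
  ultimately show "acts_as_rotation A S w"
    unfolding acts_as_rotation_def by (intro exI[of _ ?u] conjI)
qed

section \<open>The Gramian on the kernel and on a rotation plane when e^{TA} = \<sigma> Id\<close>

lemma gramian_skew_if_periodic:
  fixes A :: "real^'n^'n"
  assumes "transpose A = - A" "0 \<le> T" "mat_exp (T *\<^sub>R A) = \<sigma> *\<^sub>R mat 1" "\<sigma> \<in> {-1, 1}"
  shows "(A *v x) \<bullet> (gramian A T b *v y) = - (x \<bullet> (gramian A T b *v (A *v y)))"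
  \<comment> \<open>The endpoint term is quadratic in e^{TA} b, so it becomes \<sigma>^2 (x . b)(y .
    b) and cancels for either sign. What is left says that the Gramian commutes with A.\<close>
  using gramian_lyapunov[OF assms(1,2), of x b y] assms(3,4)
  by (auto simp: scaleR_matrix_vector_assoc[symmetric] matrix_vector_mult_diff_rdistrib[of 0, simplified])

text \<open>The component of e^{tA} b along v is constant, because e^{tA} preserves inner products
  and fixes v.\<close>

lemma gramian_on_kernel:
  fixes A :: "real^'n^'n"
  assumes skew: "transpose A = - A" and T: "0 \<le> T" and v: "A *v v = 0"
  shows "v \<bullet> (gramian A T b *v v) = T * (v \<bullet> b)\<^sup>2"
proof -
  have "v \<bullet> (mat_exp (t *\<^sub>R A) *v b) = v \<bullet> b" for t
    using mat_exp_skew_inner[OF skew, of t v b] mat_exp_fixes_kernel[OF v, of t] by simp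
  then show ?thesis
    using T by (simp add: gramian_form power2_eq_square)
qed

text \<open>Commuting with the rotation removes the off-diagonal value and makes the diagonal values
  equal. Their common value comes from their sum, whose integrand is a conserved quantity.\<close>

lemma gramian_on_plane:
  fixes A :: "real^'n^'n"
  assumes skew: "transpose A = - A" and T: "0 \<le> T"
    and per: "mat_exp (T *\<^sub>R A) = \<sigma> *\<^sub>R mat 1" "\<sigma> \<in> {-1, 1}"
    and w: "w > 0" and A: "A *v u = w *\<^sub>R v" "A *v v = - w *\<^sub>R u"
  shows "u \<bullet> (gramian A T b *v v) = 0"
    and "u \<bullet> (gramian A T b *v u) = T / 2 * ((u \<bullet> b)\<^sup>2 + (v \<bullet> b)\<^sup>2)"
    and "v \<bullet> (gramian A T b *v v) = T / 2 * ((u \<bullet> b)\<^sup>2 + (v \<bullet> b)\<^sup>2)"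
proof -
  let ?G = "gramian A T b"
  note G = gramian_skew_if_periodic[OF skew T per, of _ b]
  have sym: "v \<bullet> (?G *v u) = u \<bullet> (?G *v v)"
    using symmetric_matrix_inner[OF transpose_gramian, of v A T b u] by (simp add: inner_commute)
  \<comment> \<open>Tested on (u, u), the commutation relation reads w v . Gu = - w u . Gv, hence 2
    w u . Gv = 0 by symmetry. Tested on (u, v), it equates the two diagonal values.\<close>
  show "u \<bullet> (?G *v v) = 0"
    using G[of u u] w by (simp add: A sym matrix_vector_mult_scaleR)
  have eq: "u \<bullet> (?G *v u) = v \<bullet> (?G *v v)"
    using G[of u v] w by (simp add: A matrix_vector_mult_scaleR matrix_vector_mult_minus_right)
  let ?e = "\<lambda>t. mat_exp (t *\<^sub>R A) *v b"
  \<comment> \<open>A only rotates the pair (u . e^{tA} b, v . e^{tA} b), so the sum of squares is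
    conserved.\<close>
  have "((\<lambda>t. (u \<bullet> ?e t) * (u \<bullet> ?e t) + (v \<bullet> ?e t) * (v \<bullet> ?e t)) has_field_derivative 0) (at t)" for t
    by (rule derivative_eq_intros mat_exp_form_deriv refl)+
      (simp add: skew_matrix_inner[OF skew] A algebra_simps)
  then have "(u \<bullet> ?e t) * (u \<bullet> ?e t) + (v \<bullet> ?e t) * (v \<bullet> ?e t) =
      (u \<bullet> ?e 0) * (u \<bullet> ?e 0) + (v \<bullet> ?e 0) * (v \<bullet> ?e 0)" for t
    using DERIV_isconst_all[of "\<lambda>t. (u \<bullet> ?e t) * (u \<bullet> ?e t) + (v \<bullet> ?e t) * (v \<bullet> ?e t)"] by blast
  then have const: "(u \<bullet> ?e t) * (u \<bullet> ?e t) + (v \<bullet> ?e t) * (v \<bullet> ?e t) = (u \<bullet> b)\<^sup>2 + (v \<bullet> b)\<^sup>2" for t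
    by (simp add: mat_exp_zero power2_eq_square)
  have "u \<bullet> (?G *v u) + v \<bullet> (?G *v v) = T * ((u \<bullet> b)\<^sup>2 + (v \<bullet> b)\<^sup>2)"
    using T unfolding gramian_form
    by (subst integral_add[symmetric]) (simp_all add: gramian_integrand_integrable const)
  with eq show "u \<bullet> (?G *v u) = T / 2 * ((u \<bullet> b)\<^sup>2 + (v \<bullet> b)\<^sup>2)"
    "v \<bullet> (?G *v v) = T / 2 * ((u \<bullet> b)\<^sup>2 + (v \<bullet> b)\<^sup>2)"
    by simp_all
qed

lemma modal_decomposition_planeE:
  assumes "modal_decomposition A L V \<omega>" "l \<in> {1..L}"
  obtains u v where "u \<bullet> u = 1" "v \<bullet> v = 1" "u \<bullet> v = 0" "V l = span {u, v}"
    "A *v u = \<omega> l *\<^sub>R v" "A *v v = - \<omega> l *\<^sub>R u" "\<omega> l > 0"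
proof -
  have "acts_as_rotation A (V l) (\<omega> l)" "\<omega> l > 0"
    using assms unfolding modal_decomposition_def by blast+
  then show ?thesis
    unfolding acts_as_rotation_iff using that by metis
qed

lemma modal_decomposition_kernelE:
  assumes "modal_decomposition A L V \<omega>" "dim (V 0) = 1"
  obtains v where "norm v = 1" "V 0 = span {v}" "A *v v = 0"
proof -
  have V0: "V 0 = mat_ker A" using assms unfolding modal_decomposition_def by blast
  have sub: "subspace (V 0)"
    unfolding V0 mat_ker_def by (rule subspaceI) (simp_all add: matrix_vector_right_distrib matrix_vector_mult_scaleR)
  from assms(2) obtain x where x: "x \<in> V 0" "x \<noteq> 0"
    by (metis dim_eq_0 subset_singleton_iff subsetI singletonI zero_neq_one)
  define v where "v = (1 / norm x) *\<^sub>R x"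
  have v: "norm v = 1" "v \<in> V 0"
    using x sub by (auto simp: v_def subspace_scale)
  have "span {v} = V 0"
  proof (rule subspace_dim_equal)
    show "dim (V 0) \<le> dim (span {v})"
      using v assms(2) by (auto simp: dim_insert)
    show "span {v} \<subseteq> V 0"
      using v sub by (intro span_minimal) auto
  qed (use sub in simp_all)
  with v show ?thesis
    by (intro that[of v]) (auto simp: V0 mat_ker_def)
qed

lemma modal_decomposition_subspace:
  assumes "modal_decomposition A L V \<omega>" "l \<le> L"
  shows "subspace (V l)"
proof (cases "l = 0")
  case True
  then show ?thesis
    using assms unfolding modal_decomposition_def mat_ker_def
    by (auto intro!: subspaceI simp: matrix_vector_right_distrib matrix_vector_mult_scaleR)
next
  case False
  then have "l \<in> {1..L}" using assms by simp
  then show ?thesis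
    by (rule modal_decomposition_planeE[OF assms(1)]) simp
qed

text \<open>Each mode lies in an eigenspace of A^2, and different modes have different eigenvalues;
  this is how they are told apart below.\<close>

lemma modal_decomposition_square:
  assumes "modal_decomposition A L V \<omega>" "l \<le> L" "x \<in> V l"
  shows "A *v (A *v x) = - (if l = 0 then 0 else (\<omega> l)\<^sup>2) *\<^sub>R x"
proof (cases "l = 0")
  case True
  then show ?thesis
    using assms unfolding modal_decomposition_def mat_ker_def by auto
next
  case False
  then have "l \<in> {1..L}" using assms by simp
  then obtain u v where uv: "V l = span {u, v}"
    "A *v u = \<omega> l *\<^sub>R v" "A *v v = - \<omega> l *\<^sub>R u"
    by (rule modal_decomposition_planeE[OF assms(1)])
  then obtain a c where "x = a *\<^sub>R u + c *\<^sub>R v"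
    using assms(3) span_pairE by metis
  then show ?thesis
    using False uv
    by (simp add: matrix_vector_right_distrib matrix_vector_mult_scaleR power2_eq_square algebra_simps)
qed

text \<open>Verbatim the weight condition of the theorem, so that it can be folded there. For a
  trivial kernel the first clause is void.\<close>

definition modal_weights :: "nat \<Rightarrow> (nat \<Rightarrow> (real^'n) set) \<Rightarrow> real^'n \<Rightarrow> bool" where
  "modal_weights L V b \<longleftrightarrow>
     (dim (V 0) = 1 \<longrightarrow> (norm (orth_proj (V 0) b))\<^sup>2 = 1 / real CARD('n)) \<and>
     (\<forall>l\<in>{1..L}. (norm (orth_proj (V l) b))\<^sup>2 = 2 / real CARD('n))"

lemma modal_weights_if_gramian_scalar:
  fixes A :: "real^'n^'n"
  assumes skew: "transpose A = - A" and T: "0 < T"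
    and per: "mat_exp (T *\<^sub>R A) = \<sigma> *\<^sub>R mat 1" "\<sigma> \<in> {-1, 1}"
    and md: "modal_decomposition A L V \<omega>"
    and G: "gramian A T b = (T / real CARD('n)) *\<^sub>R mat 1"
  shows "modal_weights L V b"
  unfolding modal_weights_def
proof (intro conjI impI ballI)
  assume "dim (V 0) = 1"
  with md obtain v where v: "norm v = 1" "V 0 = span {v}" "A *v v = 0"
    by (rule modal_decomposition_kernelE)
  have "v \<bullet> (gramian A T b *v v) = T / real CARD('n)"
    using v by (simp add: G dot_square_norm scaleR_matrix_vector_assoc[symmetric])
  then have "T * (v \<bullet> b)\<^sup>2 = T * (1 / real CARD('n))"
    using gramian_on_kernel[OF skew _ v(3), of T b] T by simp
  then show "(norm (orth_proj (V 0) b))\<^sup>2 = 1 / real CARD('n)"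
    using T unfolding v(2) orth_proj_line_norm[OF v(1)] mult_cancel_left by simp
next
  fix l assume "l \<in> {1..L}"
  with md obtain u v where uv: "u \<bullet> u = 1" "v \<bullet> v = 1" "u \<bullet> v = 0" "V l = span {u, v}"
    "A *v u = \<omega> l *\<^sub>R v" "A *v v = - \<omega> l *\<^sub>R u" "\<omega> l > 0"
    by (rule modal_decomposition_planeE)
  have "u \<bullet> (gramian A T b *v u) = T / real CARD('n)"
    using uv by (simp add: G scaleR_matrix_vector_assoc[symmetric])
  then have "T * ((u \<bullet> b)\<^sup>2 + (v \<bullet> b)\<^sup>2) = T * (2 / real CARD('n))"
    using gramian_on_plane(2)[OF skew _ per uv(7,5,6), of b] T by simp
  then show "(norm (orth_proj (V l) b))\<^sup>2 = 2 / real CARD('n)"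
    using T unfolding uv(4) orth_proj_plane_norm[OF uv(1-3)] mult_cancel_left by simp
qed

text \<open>Different modes are separated by A^2, with which the Gramian commutes; inside a mode the
  weight produces the factor T/n. The bilinear identity is thus known for vectors taken from modes
  and is extended by linearity in one argument at a time.\<close>

lemma gramian_scalar_if_modal_weights:
  fixes A :: "real^'n^'n"
  assumes skew: "transpose A = - A" and T: "0 < T"
    and per: "mat_exp (T *\<^sub>R A) = \<sigma> *\<^sub>R mat 1" "\<sigma> \<in> {-1, 1}"
    and md: "modal_decomposition A L V \<omega>" and b: "modal_weights L V b"
  shows "gramian A T b = (T / real CARD('n)) *\<^sub>R mat 1"
proof -
  let ?G = "gramian A T b" and ?c = "T / real CARD('n)"
  let ?q = "\<lambda>l. if l = 0 then 0 else (\<omega> l)\<^sup>2"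
  note G = gramian_skew_if_periodic[OF skew less_imp_le[OF T] per, of _ b]
  have sym: "x \<bullet> (?G *v y) = y \<bullet> (?G *v x)" for x y
    using symmetric_matrix_inner[OF transpose_gramian, of x A T b y] by (simp add: inner_commute)
  have form: "x \<bullet> (?G *v y) = ?c * (x \<bullet> y)" if ij: "i \<le> L" "j \<le> L" and xy: "x \<in> V i" "y \<in> V j" for i j x y
  proof -
    consider "i \<noteq> j" | "i = 0" "j = 0" | "i \<in> {1..L}" "i = j"
      using ij by fastforce
    then show ?thesis
    proof cases
      case 1
      have inj: "inj_on \<omega> {1..L}" and pos: "\<And>l. l \<in> {1..L} \<Longrightarrow> \<omega> l > 0"
        and orth: "orthogonal x y"
        using md 1 ij xy unfolding modal_decomposition_def by blast+
      have "?q i \<noteq> ?q j"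
        using 1 ij pos[of i] pos[of j] inj_onD[OF inj, of i j] by (auto simp: power2_eq_iff)
      \<comment> \<open>Two applications of the commutation relation move A^2 from x to y; as the
        eigenvalues differ, x . Gy must be zero.\<close>
      moreover have "- ?q i * (x \<bullet> (?G *v y)) = - ?q j * (x \<bullet> (?G *v y))"
        using G[of "A *v x" y] G[of x "A *v y"]
        unfolding modal_decomposition_square[OF md ij(1) xy(1)] modal_decomposition_square[OF md ij(2) xy(2)]
        by (simp only: matrix_vector_mult_scaleR inner_scaleR_left inner_scaleR_right minus_minus)
      ultimately show ?thesis using orth by (simp add: orthogonal_def)
    next
      case 2
      show ?thesis
      proof (cases "dim (V 0) = 1")
        case True
        with md obtain v where v: "norm v = 1" "V 0 = span {v}" "A *v v = 0"
          by (rule modal_decomposition_kernelE)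
        have "(v \<bullet> b)\<^sup>2 = 1 / real CARD('n)"
          using b True orth_proj_line_norm[OF v(1), of b] v(2) by (simp add: modal_weights_def)
        then have "v \<bullet> (?G *v v) = ?c"
          using gramian_on_kernel[OF skew _ v(3), of T b] T by simp
        moreover obtain a d where "x = a *\<^sub>R v" "y = d *\<^sub>R v"
          using xy 2 v(2) by (auto simp: span_singleton)
        ultimately show ?thesis
          using v by (simp add: matrix_vector_mult_scaleR dot_square_norm)
      next
        case False
        then have "dim (V 0) = 0"
          using md unfolding modal_decomposition_def by blast
        then have "x = 0" using xy 2 by auto
        then show ?thesis by simp
      qed
    next
      case 3
      with md obtain u v where uv: "u \<bullet> u = 1" "v \<bullet> v = 1" "u \<bullet> v = 0" "V i = span {u, v}"
        "A *v u = \<omega> i *\<^sub>R v" "A *v v = - \<omega> i *\<^sub>R u" "\<omega> i > 0"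
        using modal_decomposition_planeE by metis
      have "(u \<bullet> b)\<^sup>2 + (v \<bullet> b)\<^sup>2 = 2 / real CARD('n)"
        using b 3 unfolding orth_proj_plane_norm[OF uv(1-3), symmetric] uv(4)[symmetric] modal_weights_def
        by blast
      then have "u \<bullet> (?G *v u) = ?c" "v \<bullet> (?G *v v) = ?c" "u \<bullet> (?G *v v) = 0" "v \<bullet> (?G *v u) = 0"
        using gramian_on_plane[OF skew less_imp_le[OF T] per uv(7,5,6), of b] sym[of v u] by simp_all
      moreover obtain a d where "x = a *\<^sub>R u + d *\<^sub>R v"
        using xy 3 uv(4) span_pairE by metis
      moreover obtain a' d' where "y = a' *\<^sub>R u + d' *\<^sub>R v"
        using xy 3 uv(4) span_pairE by metis
      ultimately show ?thesis
        using uv(1-3) inner_commute[of v u]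
        by (simp add: matrix_vector_right_distrib matrix_vector_mult_scaleR inner_add_left inner_add_right
            algebra_simps)
    qed
  qed
  have span: "span (\<Union>l\<le>L. V l) = UNIV"
    using md unfolding modal_decomposition_def by blast
  have on_modes: "?G *v y = ?c *\<^sub>R y" if "j \<le> L" "y \<in> V j" for j y
  proof -
    let ?S = "{x. x \<bullet> (?G *v y - ?c *\<^sub>R y) = 0}"
    have "subspace ?S"
      by (rule subspace_hyperplane2)
    moreover have "(\<Union>l\<le>L. V l) \<subseteq> ?S"
      using form that by (auto simp: inner_diff_right)
    ultimately have "x \<in> ?S" for x
      using span span_minimal by blast
    then have "(?G *v y - ?c *\<^sub>R y) \<bullet> (?G *v y - ?c *\<^sub>R y) = 0" by blast
    then show ?thesis by simp
  qed
  have "subspace {y. ?G *v y = ?c *\<^sub>R y}"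
    by (rule subspaceI) (simp_all add: matrix_vector_right_distrib matrix_vector_mult_scaleR scaleR_add_right)
  moreover have "(\<Union>l\<le>L. V l) \<subseteq> {y. ?G *v y = ?c *\<^sub>R y}"
    using on_modes by blast
  ultimately have "?G *v y = ?c *\<^sub>R y" for y
    using span span_minimal by blast
  then show ?thesis
    by (simp add: matrix_eq scaleR_matrix_vector_assoc[symmetric])
qed

text \<open>One vector of the prescribed length is taken from each mode, in an arbitrary direction.
  As the modes are orthogonal, the projections of the sum are the chosen vectors.\<close>

lemma modal_weights_exists:
  fixes A :: "real^'n^'n"
  assumes md: "modal_decomposition A L V \<omega>"
  obtains b where "modal_weights L V b"
proof -
  have "\<exists>w. w \<in> V l \<and> (l = 0 \<longrightarrow> dim (V 0) = 1 \<longrightarrow> (norm w)\<^sup>2 = 1 / real CARD('n)) \<and>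
      (l \<noteq> 0 \<longrightarrow> (norm w)\<^sup>2 = 2 / real CARD('n))" if l: "l \<le> L" for l
  proof -
    consider "l = 0" "dim (V 0) = 1" | "l = 0" "dim (V 0) \<noteq> 1" | "l \<in> {1..L}"
      using l by fastforce
    then show ?thesis
    proof cases
      case 1
      obtain v where v: "norm v = 1" "V 0 = span {v}"
        using modal_decomposition_kernelE[OF md 1(2)] by metis
      show ?thesis
        by (rule exI[of _ "sqrt (1 / real CARD('n)) *\<^sub>R v"]) (use 1 v in \<open>auto simp: span_base span_scale power_mult_distrib power_divide real_sqrt_divide\<close>)
    next
      case 2
      \<comment> \<open>With a trivial kernel, zero fills the slot of index 0 in the sum over l <=
        L.\<close>
      have "0 \<in> V l"
        using modal_decomposition_subspace[OF md l] by (rule subspace_0)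
      then show ?thesis using 2 by auto
    next
      case 3
      with md obtain u v where uv: "u \<bullet> u = 1" "V l = span {u, v}"
        using modal_decomposition_planeE by metis
      then have "norm u = 1" by (simp add: norm_eq_sqrt_inner)
      then show ?thesis
        by (intro exI[of _ "sqrt (2 / real CARD('n)) *\<^sub>R u"])
          (use 3 uv in \<open>auto simp: span_base span_scale power_mult_distrib\<close>)
    qed
  qed
  then obtain w where w: "\<And>l. l \<le> L \<Longrightarrow> w l \<in> V l"
    "dim (V 0) = 1 \<Longrightarrow> (norm (w 0))\<^sup>2 = 1 / real CARD('n)"
    "\<And>l. l \<in> {1..L} \<Longrightarrow> (norm (w l))\<^sup>2 = 2 / real CARD('n)"
    by (metis atLeastAtMost_iff le0 not_one_le_zero)
  define b where "b = (\<Sum>l\<le>L. w l)"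
  have proj: "orth_proj (V l) b = w l" if l: "l \<le> L" for l
  proof (rule orth_proj_eq)
    show "subspace (V l)" by (rule modal_decomposition_subspace[OF md l])
    show "w l \<in> V l" using w l by blast
    fix z assume z: "z \<in> V l"
    have "b - w l = (\<Sum>j\<in>{..L} - {l}. w j)"
      using l by (simp add: b_def sum_diff1)
    moreover have "orthogonal (w j) z" if "j \<in> {..L} - {l}" for j
      using md w(1)[of j] z l that unfolding modal_decomposition_def by auto
    ultimately show "orthogonal (b - w l) z"
      by (simp add: orthogonal_def inner_sum_left)
  qed
  show ?thesis
    by (rule that[of b]) (use w proj in \<open>auto simp: modal_weights_def\<close>)
qed

section \<open>Existence of a modal decomposition for cyclic skew matrices\<close>

lemma invariant_subspace_powers:
  fixes A :: "real^'n^'n"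
  assumes "\<And>x. x \<in> S \<Longrightarrow> A *v x \<in> S" "x \<in> S"
  shows "mat_pow A k *v x \<in> S"
proof (induction k)
  case 0
  show ?case using assms(2) by (simp add: mat_pow_0)
next
  case (Suc k)
  from assms(1)[OF this] show ?case
    by (simp add: mat_pow_Suc matrix_vector_mul_assoc)
qed

text \<open>The orthogonal complement of \<open>W\<close> is invariant too, so the projection of a cyclic vector
  to \<open>W\<close> is cyclic for the restriction of \<open>A\<close> to \<open>W\<close>.\<close>

lemma skew_cyclic_restricts_to_invariant_subspace:
  fixes A :: "real^'n^'n"
  assumes skew: "transpose A = - A" and b: "span (range (\<lambda>k. mat_pow A k *v b)) = UNIV"
    and W: "subspace W" "\<And>x. x \<in> W \<Longrightarrow> A *v x \<in> W"
  obtains w where "w \<in> W" "W \<subseteq> span (range (\<lambda>k. mat_pow A k *v w))"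
proof -
  have spanW: "span W = W" using W by (simp add: span_eq_iff)
  obtain w w' where w: "w \<in> W" "b = w + w'" and w': "\<And>z. z \<in> W \<Longrightarrow> orthogonal w' z"
    using orthogonal_subspace_decomp_exists[of W b] unfolding spanW by metis
  let ?K = "span (range (\<lambda>k. mat_pow A k *v w))"
  let ?C = "{x. \<forall>z\<in>W. orthogonal x z}"
  have C: "A *v x \<in> ?C" if "x \<in> ?C" for x
    using that W(2) skew_matrix_inner[OF skew] by (fastforce simp: orthogonal_def)
  have "w' \<in> ?C" using w' by blast
  then have "mat_pow A k *v w' \<in> ?C" for k
    using invariant_subspace_powers[of ?C A w' k] C by blast
  then have powers: "mat_pow A k *v b \<in> {x + y | x y. x \<in> ?K \<and> y \<in> ?C}" for k
    unfolding w(2) matrix_vector_right_distrib by (blast intro: span_base)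
  have "subspace ?C"
    by (rule subspaceI) (auto simp: orthogonal_def inner_add_left)
  then have "subspace {x + y | x y. x \<in> ?K \<and> y \<in> ?C}"
    by (intro subspace_sums subspace_span)
  \<comment> \<open>The powers of b split into a part in the Krylov space of w and a part orthogonal
    to W, hence so does every vector. For a vector of W the second part lies in W as well, so it
    vanishes.\<close>
  then have all: "x \<in> {x + y | x y. x \<in> ?K \<and> y \<in> ?C}" for x
    using span_minimal[of "range (\<lambda>k. mat_pow A k *v b)"] powers b by blast
  have "?K \<subseteq> W"
    using invariant_subspace_powers[of W A w] W w(1) by (intro span_minimal) auto
  have "y \<in> ?K" if y: "y \<in> W" for y
  proof -
    obtain x z where xz: "y = x + z" "x \<in> ?K" "z \<in> ?C" using all[of y] by blast
    then have "z \<in> W"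
      using y \<open>?K \<subseteq> W\<close> W(1) by (metis add_diff_cancel_left' subsetD subspace_diff)
    then have "z = 0" using xz(3) by (auto simp: orthogonal_self)
    then show ?thesis using xz by simp
  qed
  with w(1) show ?thesis by (intro that[of w]) auto
qed

lemma skew_square_inner:
  fixes A :: "real^'n^'n"
  assumes "transpose A = - A"
  shows "x \<bullet> (A *v (A *v x)) = - (norm (A *v x))\<^sup>2"
  using skew_matrix_inner[OF assms, of x "A *v x"] by (simp add: power2_norm_eq_inner)

lemma transpose_skew_square:
  fixes A :: "real^'n^'n"
  assumes "transpose A = - A"
  shows "transpose (A ** A) = A ** A"
proof -
  have "(- A) ** (- A) = A ** A"
    by (simp add: matrix_matrix_mult_def vec_eq_iff)
  then show ?thesis by (simp add: matrix_transpose_mul assms)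
qed

text \<open>On the kernel all powers of A beyond the zeroth vanish, so the Krylov space that has to
  contain the kernel is spanned by a single vector.\<close>

lemma skew_cyclic_kernel_dim:
  fixes A :: "real^'n^'n"
  assumes skew: "transpose A = - A" and b: "span (range (\<lambda>k. mat_pow A k *v b)) = UNIV"
  shows "dim (mat_ker A) \<le> 1"
proof -
  have "subspace (mat_ker A)"
    unfolding mat_ker_def by (rule subspaceI) (simp_all add: matrix_vector_right_distrib matrix_vector_mult_scaleR)
  then obtain w where w: "w \<in> mat_ker A" "mat_ker A \<subseteq> span (range (\<lambda>k. mat_pow A k *v w))"
    by (rule skew_cyclic_restricts_to_invariant_subspace[OF skew b]) (auto simp: mat_ker_def)
  have "A *v x \<in> span {w}" if "x \<in> span {w}" for x
  proof -
    have "A *v x = 0"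
      using that w(1) by (auto simp: span_singleton mat_ker_def matrix_vector_mult_scaleR)
    then show ?thesis by (simp add: span_zero)
  qed
  then have "mat_pow A k *v w \<in> span {w}" for k
    by (rule invariant_subspace_powers) (auto intro: span_base)
  then have "mat_ker A \<subseteq> span {w}"
    using w(2) span_minimal[of "range (\<lambda>k. mat_pow A k *v w)" "span {w}"] by blast
  then show ?thesis using dim_le_card[of "mat_ker A" "{w}"] by simp
qed

text \<open>A^2 acts on the eigenspace as a scalar, so a Krylov space in it is spanned by y and Ay,
  and cyclicity bounds the dimension by two. Conversely x and Ax already are two orthogonal
  directions.\<close>

lemma skew_cyclic_eigenspace_rotation:
  fixes A :: "real^'n^'n"
  assumes skew: "transpose A = - A" and b: "span (range (\<lambda>k. mat_pow A k *v b)) = UNIV"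
    and w: "w > 0" and x: "x \<noteq> 0" "A *v (A *v x) = - (w\<^sup>2) *\<^sub>R x"
  shows "acts_as_rotation A {x. A *v (A *v x) = - (w\<^sup>2) *\<^sub>R x} w"
proof -
  let ?W = "{x. A *v (A *v x) = - (w\<^sup>2) *\<^sub>R x}"
  have W: "subspace ?W"
    by (rule subspaceI) (simp_all add: matrix_vector_right_distrib matrix_vector_mult_scaleR algebra_simps)
  have inv: "A *v x \<in> ?W" if "x \<in> ?W" for x
    using that by (simp add: matrix_vector_mult_scaleR matrix_vector_mult_minus_right)
  have "dim ?W \<le> 2"
  proof -
    obtain y where y: "y \<in> ?W" "?W \<subseteq> span (range (\<lambda>k. mat_pow A k *v y))"
      by (rule skew_cyclic_restricts_to_invariant_subspace[OF skew b W inv])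
    have "A *v z \<in> span {y, A *v y}" if "z \<in> span {y, A *v y}" for z
    proof -
      have "A *v z \<in> span ((*v) A ` {y, A *v y})"
        using that by (simp only: linear_span_image[OF matrix_vector_mul_linear] imageI)
      moreover have "(*v) A ` {y, A *v y} \<subseteq> span {y, A *v y}"
      proof -
        have "- (w\<^sup>2) *\<^sub>R y \<in> span {y, A *v y}"
          by (intro span_scale span_base) simp
        then show ?thesis using y(1) by (auto intro: span_base)
      qed
      ultimately show ?thesis
        using span_minimal[OF _ subspace_span] by blast
    qed
    then have "mat_pow A k *v y \<in> span {y, A *v y}" for k
      by (rule invariant_subspace_powers) (auto intro: span_base)
    then have "?W \<subseteq> span {y, A *v y}"
      using y(2) span_minimal[of "range (\<lambda>k. mat_pow A k *v y)" "span {y, A *v y}"] by blast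
    then have "dim ?W \<le> card {y, A *v y}"
      by (intro dim_le_card) auto
    also have "\<dots> \<le> 2" by (simp add: card_insert_if)
    finally show ?thesis .
  qed
  \<comment> \<open>The order of u and v = Au / w gives the orientation demanded by
    \<open>J\<close>: Au = w v holds by construction, and Av = -w u is the eigenvalue
    equation.\<close>
  define u where "u = (1 / norm x) *\<^sub>R x"
  define v where "v = (1 / w) *\<^sub>R (A *v u)"
  have u: "u \<in> ?W" "norm u = 1" "u \<bullet> u = 1"
  proof -
    show "u \<in> ?W"
      unfolding u_def by (rule subspace_scale[OF W]) (use x in simp)
    show "norm u = 1" using x by (simp add: u_def)
    then show "u \<bullet> u = 1" by (simp add: dot_square_norm)
  qed
  have v: "v \<in> ?W"
    unfolding v_def by (rule subspace_scale[OF W inv[OF u(1)]])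
  have Au: "A *v u = w *\<^sub>R v" using w by (simp add: v_def)
  have Av: "A *v v = - w *\<^sub>R u"
    using u(1) w by (simp add: v_def matrix_vector_mult_scaleR power2_eq_square)
  have "u \<bullet> (A *v u) = 0"
    using skew_matrix_inner[OF skew, of u u] by (simp add: inner_commute)
  then have uv: "u \<bullet> v = 0" by (simp add: v_def)
  have "w * (v \<bullet> v) = - (u \<bullet> (A *v v))"
    using skew_matrix_inner[OF skew, of u v] by (simp add: Au)
  then have vv: "v \<bullet> v = 1" using u w by (simp add: Av)
  have "span {u, v} = ?W"
  proof (rule subspace_dim_equal)
    have "u \<noteq> v" using uv vv by auto
    have "independent {u, v}"
      by (rule pairwise_orthogonal_independent)
        (use u vv uv in \<open>auto simp: pairwise_insert orthogonal_def inner_commute\<close>)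
    then have "dim {u, v} = 2"
      using \<open>u \<noteq> v\<close> by (simp add: dim_eq_card_independent)
    then show "dim ?W \<le> dim (span {u, v})"
      using \<open>dim ?W \<le> 2\<close> by simp
    show "span {u, v} \<subseteq> ?W"
      using u(1) v W by (intro span_minimal) auto
  qed (use W in simp_all)
  with u(3) vv uv Au Av show ?thesis
    unfolding acts_as_rotation_iff by blast
qed

text \<open>Otherwise the orthogonal complement of these eigenspaces is nonzero and invariant under
  A^2, hence contains an eigenvector of A^2, which would be orthogonal to itself.\<close>

lemma span_skew_square_eigenspaces:
  fixes A :: "real^'n^'n"
  assumes skew: "transpose A = - A"
  shows "span (mat_ker A \<union> {x. \<exists>w>0. A *v (A *v x) = - (w\<^sup>2) *\<^sub>R x}) = UNIV"
proof (rule ccontr)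
  let ?X = "mat_ker A \<union> {x. \<exists>w>0. A *v (A *v x) = - (w\<^sup>2) *\<^sub>R x}"
  assume "span ?X \<noteq> UNIV"
  then have "dim ?X < DIM(real^'n)"
    using dim_eq_full[of ?X] dim_subset_UNIV[of ?X] by linarith
  then obtain v where v: "v \<noteq> 0" "\<And>y. y \<in> span ?X \<Longrightarrow> orthogonal v y"
    using orthogonal_to_subspace_exists by blast
  let ?C = "{x. \<forall>y\<in>?X. orthogonal x y}"
  have C: "subspace ?C" "?C \<noteq> {0}"
  proof -
    show "subspace ?C"
      by (rule subspaceI) (auto simp: orthogonal_def inner_add_left)
    have "v \<in> ?C"
    proof (intro CollectI ballI)
      show "orthogonal v y" if "y \<in> ?X" for y
        by (rule v(2)[OF span_base[OF that]])
    qed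
    then show "?C \<noteq> {0}" using v(1) by (metis singletonD)
  qed
  have inv: "(A ** A) *v x \<in> ?C" if x: "x \<in> ?C" for x
  proof -
    have "((A ** A) *v x) \<bullet> y = 0" if y: "y \<in> ?X" for y
    proof -
      have "A *v (A *v y) = 0 *\<^sub>R y \<or> (\<exists>w>0. A *v (A *v y) = - (w\<^sup>2) *\<^sub>R y)"
        using y by (auto simp: mat_ker_def)
      then obtain c where "(A ** A) *v y = c *\<^sub>R y"
        unfolding matrix_vector_mul_assoc by blast
      then show ?thesis
        using symmetric_matrix_inner[OF transpose_skew_square[OF skew], of x y] x y
        by (auto simp: orthogonal_def)
    qed
    then show ?thesis by (simp add: orthogonal_def)
  qed
  obtain x m where x: "x \<in> ?C" "norm x = 1" "(A ** A) *v x = m *\<^sub>R x"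
    by (rule rayleigh_minimizer[OF transpose_skew_square[OF skew] C inv]) (assumption | rule that; assumption)+
  \<comment> \<open>The eigenvalue is m = x . A^2 x = -|Ax|^2, so |Ax| is the frequency; if it is
    zero, x lies in the kernel.\<close>
  have "m = - (norm (A *v x))\<^sup>2"
    using skew_square_inner[OF skew, of x] x(2,3)
    by (simp add: matrix_vector_mul_assoc dot_square_norm)
  then have "A *v (A *v x) = - ((norm (A *v x))\<^sup>2) *\<^sub>R x"
    using x(3) by (simp add: matrix_vector_mul_assoc)
  then have "x \<in> ?X"
    unfolding mat_ker_def using zero_less_norm_iff by blast
  then have "orthogonal x x" using x(1) by blast
  then show False using x(2) by (simp add: orthogonal_self)
qed

lemma modal_decomposition_exists:
  fixes A :: "real^'n^'n"
  assumes skew: "transpose A = - A" and "cyclic A"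
  shows "\<exists>L V \<omega>. modal_decomposition A L V \<omega>"
proof -
  obtain b where b: "span (range (\<lambda>k. mat_pow A k *v b)) = UNIV"
    using \<open>cyclic A\<close> unfolding cyclic_iff_span_all_powers by blast
  let ?W = "\<lambda>w. {x. A *v (A *v x) = - (w\<^sup>2) *\<^sub>R x}"
  \<comment> \<open>The set of frequencies. It is finite because w |-> -w^2 maps it injectively to
    eigenvalues of the symmetric matrix A^2; numbering it from 1 leaves index 0 to the
    kernel.\<close>
  define \<Omega> where "\<Omega> = {w. w > 0 \<and> (\<exists>x\<noteq>0. x \<in> ?W w)}"
  have "finite ((\<lambda>w. - (w\<^sup>2)) ` \<Omega>)"
    by (rule finite_subset[OF _ finite_eigenvalues[OF transpose_skew_square[OF skew]]])
      (auto simp: \<Omega>_def eigenvalues_def matrix_vector_mul_assoc)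
  moreover have "inj_on (\<lambda>w. - (w\<^sup>2)) \<Omega>"
    by (rule inj_onI) (auto simp: \<Omega>_def power2_eq_iff)
  ultimately have "finite \<Omega>" by (rule finite_imageD)
  then obtain \<omega> where \<omega>: "bij_betw \<omega> {1..card \<Omega>} \<Omega>"
    using ex_bij_betw_nat_finite_1 by blast
  let ?L = "card \<Omega>"
  define V where "V l = (if l = 0 then mat_ker A else ?W (\<omega> l))" for l
  define q where "q l = (if l = 0 then 0 else - ((\<omega> l)\<^sup>2))" for l
  have in\<Omega>: "\<omega> l \<in> \<Omega>" if "l \<in> {1..?L}" for l
    using \<omega> that bij_betwE by blast
  have inj: "inj_on \<omega> {1..?L}" using \<omega> by (rule bij_betw_imp_inj_on)
  have qV: "(A ** A) *v x = q l *\<^sub>R x" if "x \<in> V l" for l x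
    using that by (auto simp: V_def q_def mat_ker_def matrix_vector_mul_assoc[symmetric] split: if_splits)
  have q_inj: "q i \<noteq> q j" if "i \<le> ?L" "j \<le> ?L" "i \<noteq> j" for i j
    using in\<Omega>[of i] in\<Omega>[of j] inj_onD[OF inj, of i j] that
    by (auto simp: q_def \<Omega>_def power2_eq_iff)
  have "modal_decomposition A ?L V \<omega>"
    unfolding modal_decomposition_def
  proof (intro conjI ballI allI impI)
    show "V 0 = mat_ker A" by (simp add: V_def)
    have "dim (V 0) \<le> 1"
      using skew_cyclic_kernel_dim[OF skew b] by (simp add: V_def)
    then have "dim (V 0) = 0 \<or> dim (V 0) = 1" by linarith
    then show "dim (V 0) \<in> {0, 1}" by blast
    fix l assume l: "l \<in> {1..?L}"
    then show "0 < \<omega> l" using in\<Omega> by (simp add: \<Omega>_def)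
    obtain x where "x \<noteq> 0" "x \<in> ?W (\<omega> l)"
      using in\<Omega>[OF l] unfolding \<Omega>_def by blast
    then show "acts_as_rotation A (V l) (\<omega> l)"
      using skew_cyclic_eigenspace_rotation[OF skew b \<open>0 < \<omega> l\<close>, of x] l by (simp add: V_def)
  next
    show "inj_on \<omega> {1..?L}" by (fact inj)
  next
    fix i j x y assume "i \<le> ?L" "j \<le> ?L" "i \<noteq> j" "x \<in> V i" "y \<in> V j"
    then show "orthogonal x y"
      unfolding orthogonal_def
      using symmetric_eigenvectors_orthogonal[OF transpose_skew_square[OF skew] qV qV q_inj] by blast
  next
    have "mat_ker A \<union> {x. \<exists>w>0. A *v (A *v x) = - (w\<^sup>2) *\<^sub>R x} \<subseteq> span (\<Union>l\<le>?L. V l)"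
    proof (intro Un_least subsetI)
      fix x assume "x \<in> mat_ker A"
      then have "x \<in> V 0" by (simp add: V_def)
      then show "x \<in> span (\<Union>l\<le>?L. V l)" by (blast intro: span_base)
    next
      fix x assume "x \<in> {x. \<exists>w>0. A *v (A *v x) = - (w\<^sup>2) *\<^sub>R x}"
      then obtain w where w: "w > 0" "x \<in> ?W w" by blast
      show "x \<in> span (\<Union>l\<le>?L. V l)"
      proof (cases "x = 0")
        case False
        then have "w \<in> \<omega> ` {1..?L}"
          using w \<omega> unfolding bij_betw_def \<Omega>_def by blast
        then obtain l where "l \<in> {1..?L}" "w = \<omega> l" by blast
        then have "x \<in> V l" "l \<le> ?L" using w by (auto simp: V_def)
        then show ?thesis by (blast intro: span_base)
      qed (simp add: span_zero)
    qed
    then have "UNIV \<subseteq> span (\<Union>l\<le>?L. V l)"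
      unfolding span_skew_square_eigenspaces[OF skew, symmetric]
      by (rule span_minimal[OF _ subspace_span])
    then show "span (\<Union>l\<le>?L. V l) = UNIV" by blast
  qed
  then show ?thesis by blast
qed

section \<open>Equality of the two maxima\<close>

lemma gamma_1_eq_gamma_rel_iff:
  fixes A :: "real^'n^'n"
  assumes "transpose A = - A" "0 \<le> T"
  shows "gamma_1 A T = gamma_rel A T \<longleftrightarrow>
    (\<exists>b. norm b = 1 \<and> gramian A T b = (T / real CARD('n)) *\<^sub>R mat 1)"
proof
  assume "gamma_1 A T = gamma_rel A T"
  then show "\<exists>b. norm b = 1 \<and> gramian A T b = (T / real CARD('n)) *\<^sub>R mat 1"
    using gamma_1_attained[of A T] gramian_eq_if_lambda_min_maximal[OF assms] gamma_rel_skew[OF assms]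
    by metis
next
  assume "\<exists>b. norm b = 1 \<and> gramian A T b = (T / real CARD('n)) *\<^sub>R mat 1"
  then obtain b where b: "norm b = 1" "lambda_min (gramian A T b) = T / real CARD('n)"
    by (metis lambda_min_scaleR_mat_1)
  obtain c where c: "norm c = 1" "lambda_min (gramian A T c) = gamma_1 A T"
    and max: "\<And>d. norm d = 1 \<Longrightarrow> lambda_min (gramian A T d) \<le> gamma_1 A T"
    using gamma_1_attained[of A T] by blast
  show "gamma_1 A T = gamma_rel A T"
    using max[OF b(1)] b(2) lambda_min_gramian_le[OF assms c(1)] c(2) gamma_rel_skew[OF assms] by simp
qed

lemma mat_exp_scalar_if_gramian_scalar:
  fixes A :: "real^'n^'n"
  assumes skew: "transpose A = - A" and T: "0 < T" and b: "norm b = 1"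
    and G: "gramian A T b = c *\<^sub>R mat 1" and c: "c > 0"
  shows "\<exists>\<sigma>\<in>{-1, 1}. mat_exp (T *\<^sub>R A) = \<sigma> *\<^sub>R mat 1"
proof -
  let ?E = "mat_exp (T *\<^sub>R A)"
  let ?s = "(?E *v b) \<bullet> b"
  have outer: "(x \<bullet> b) * (y \<bullet> b) = (x \<bullet> (?E *v b)) * (y \<bullet> (?E *v b))" for x y
    using gramian_lyapunov[OF skew less_imp_le[OF T], of x b y] skew_matrix_inner[OF skew, of x y]
    by (simp add: G scaleR_matrix_vector_assoc[symmetric])
  have "b \<bullet> b = 1" using b by (simp add: dot_square_norm)
  then have bb: "b \<bullet> b = 1" "(?E *v b) \<bullet> (?E *v b) = 1"
    by (simp_all only: mat_exp_skew_inner[OF skew])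
  \<comment> \<open>Taking y = e^{TA} b, a unit vector, shows that e^{TA} b is parallel to b; x = y
    = b then shows that the factor has square one.\<close>
  have "x \<bullet> (?E *v b) = x \<bullet> (?s *\<^sub>R b)" for x
    using outer[of x "?E *v b"] bb by (simp add: mult.commute)
  then have Eb: "?E *v b = ?s *\<^sub>R b"
    using vector_eq_ldot by blast
  have "?s * ?s = 1"
    using outer[of b b] bb by (simp add: inner_commute)
  then have s: "?s \<in> {-1, 1}"
    by (auto simp: square_eq_1_iff)
  \<comment> \<open>e^{TA} commutes with A, so the eigenvalue relation passes from b to every A^k b,
    and these span the whole space.\<close>
  have "?E *v (mat_pow A k *v b) = ?s *\<^sub>R (mat_pow A k *v b)" for k
  proof (induction k)
    case 0
    show ?case using Eb by (simp add: mat_pow_0)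
  next
    case (Suc k)
    have "?E *v (mat_pow A (Suc k) *v b) = A *v (?E *v (mat_pow A k *v b))"
      by (simp add: mat_pow_Suc matrix_vector_mul_assoc matrix_mul_assoc mat_exp_commute)
    then show ?case
      unfolding Suc by (simp add: mat_pow_Suc matrix_vector_mult_scaleR matrix_vector_mul_assoc)
  qed
  then have "range (\<lambda>k. mat_pow A k *v b) \<subseteq> {x. ?E *v x = ?s *\<^sub>R x}" by blast
  moreover have "subspace {x. ?E *v x = ?s *\<^sub>R x}"
    by (rule subspaceI) (simp_all add: matrix_vector_right_distrib matrix_vector_mult_scaleR scaleR_add_right)
  ultimately have "?E *v x = ?s *\<^sub>R x" for x
    using span_minimal span_powers_if_gramian_scalar[OF G c] by blast
  then have "?E = ?s *\<^sub>R mat 1"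
    unfolding matrix_eq scaleR_matrix_vector_assoc[symmetric] matrix_vector_mul_lid by blast
  with s show ?thesis by blast
qed

theorem theorem3p2:
  fixes A :: "real^'n^'n" and T :: real
  assumes "transpose A = - A" and "T > 0"
  shows "(gamma_1 A T = gamma_rel A T \<longleftrightarrow>
            cyclic A \<and> (\<exists>\<sigma>\<in>{-1, 1}. mat_exp (T *\<^sub>R A) = \<sigma> *\<^sub>R mat 1)) \<and>
         (\<forall>\<sigma>\<in>{-1, 1}. mat_exp (T *\<^sub>R A) = \<sigma> *\<^sub>R mat 1 \<and> mat_ker A \<noteq> {0} \<longrightarrow> \<sigma> = 1) \<and>
         (cyclic A \<and> (\<exists>\<sigma>\<in>{-1, 1}. mat_exp (T *\<^sub>R A) = \<sigma> *\<^sub>R mat 1) \<longrightarrow>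
            (\<exists>L V \<omega>. modal_decomposition A L V \<omega>) \<and>
            (\<forall>L V \<omega>. modal_decomposition A L V \<omega> \<longrightarrow>
               (\<forall>b. (norm b = 1 \<and> lambda_min (gramian A T b) = gamma_1 A T) \<longleftrightarrow>
                    ((dim (V 0) = 1 \<longrightarrow> (norm (orth_proj (V 0) b))\<^sup>2 = 1 / real CARD('n)) \<and>
                     (\<forall>l\<in>{1..L}. (norm (orth_proj (V l) b))\<^sup>2 = 2 / real CARD('n)))) \<and>
               (\<forall>b. norm b = 1 \<and> lambda_min (gramian A T b) = gamma_1 A T \<longrightarrow>
                    gramian A T b = (T / real CARD('n)) *\<^sub>R mat 1)))"
proof -
  note skew = assms(1) and T = assms(2) and T0 = less_imp_le[OF assms(2)]
  let ?scalar = "\<lambda>b. gramian A T b = (T / real CARD('n)) *\<^sub>R mat 1"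
  let ?periodic = "\<exists>\<sigma>\<in>{-1, 1}. mat_exp (T *\<^sub>R A) = \<sigma> *\<^sub>R mat 1"
  have equal_if: "gamma_1 A T = gamma_rel A T" if cond: "cyclic A \<and> ?periodic"
  proof -
    obtain \<sigma> where per: "mat_exp (T *\<^sub>R A) = \<sigma> *\<^sub>R mat 1" "\<sigma> \<in> {-1, 1}"
      using cond by blast
    obtain L V \<omega> where md: "modal_decomposition A L V \<omega>"
      using modal_decomposition_exists[OF skew] cond by blast
    obtain b where b: "modal_weights L V b"
      using modal_weights_exists[OF md] .
    have "?scalar b"
      by (rule gramian_scalar_if_modal_weights[OF skew T per md b])
    then show ?thesis
      using gamma_1_eq_gamma_rel_iff[OF skew T0] norm_eq_1_if_gramian_scalar[OF skew T] by blast
  qed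
  have cond_if: "cyclic A \<and> ?periodic" if eq: "gamma_1 A T = gamma_rel A T"
  proof -
    obtain b where b: "norm b = 1" "?scalar b"
      using eq gamma_1_eq_gamma_rel_iff[OF skew T0] by blast
    have pos: "T / real CARD('n) > 0" using T by simp
    show ?thesis
      using span_powers_if_gramian_scalar[OF b(2) pos]
        mat_exp_scalar_if_gramian_scalar[OF skew T b pos]
      unfolding cyclic_iff_span_all_powers by blast
  qed
  have kernel: "\<sigma> = 1" if per: "mat_exp (T *\<^sub>R A) = \<sigma> *\<^sub>R mat 1" and ker: "mat_ker A \<noteq> {0}" for \<sigma>
  proof -
    have "0 \<in> mat_ker A" by (simp add: mat_ker_def)
    then obtain v where v: "v \<noteq> 0" "A *v v = 0"
      using ker unfolding mat_ker_def by blast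
    have "\<sigma> *\<^sub>R v = 1 *\<^sub>R v"
      using mat_exp_fixes_kernel[OF v(2), of T] per by (simp add: scaleR_matrix_vector_assoc[symmetric])
    then show ?thesis using v(1) by (metis scaleR_right_imp_eq)
  qed
  have maximizers: "(norm b = 1 \<and> lambda_min (gramian A T b) = gamma_1 A T) \<longleftrightarrow> ?scalar b"
    if "cyclic A \<and> ?periodic" for b
  proof -
    \<comment> \<open>With this value, the maximizers are the unit vectors meeting the trace bound.
      A Gramian (T/n) Id already entails norm one, so the right-hand side carries no norm
      condition.\<close>
    have "gamma_1 A T = T / real CARD('n)"
      using equal_if[OF that] gamma_rel_skew[OF skew T0] by simp
    then show ?thesis
      using gramian_eq_if_lambda_min_maximal[OF skew T0] norm_eq_1_if_gramian_scalar[OF skew T]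
      by (metis lambda_min_scaleR_mat_1)
  qed
  have weights: "?scalar b \<longleftrightarrow> modal_weights L V b"
    if "cyclic A \<and> ?periodic" "modal_decomposition A L V \<omega>" for b L V \<omega>
    using that modal_weights_if_gramian_scalar[OF skew T] gramian_scalar_if_modal_weights[OF skew T]
    by blast
  show ?thesis
    unfolding modal_weights_def[symmetric]
  proof (intro conjI allI ballI impI)
    show "gamma_1 A T = gamma_rel A T \<longleftrightarrow> cyclic A \<and> ?periodic"
      using equal_if cond_if by blast
  next
    fix \<sigma> :: real
    assume "mat_exp (T *\<^sub>R A) = \<sigma> *\<^sub>R mat 1 \<and> mat_ker A \<noteq> {0}"
    then show "\<sigma> = 1" using kernel by blast
  next
    assume "cyclic A \<and> ?periodic"
    then show "\<exists>L V \<omega>. modal_decomposition A L V \<omega>"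
      using modal_decomposition_exists[OF skew] by blast
  next
    fix L V \<omega> b
    assume "cyclic A \<and> ?periodic" "modal_decomposition A L V \<omega>"
    then show "(norm b = 1 \<and> lambda_min (gramian A T b) = gamma_1 A T) \<longleftrightarrow> modal_weights L V b"
      using maximizers weights by simp
  next
    fix b
    assume "cyclic A \<and> ?periodic" "norm b = 1 \<and> lambda_min (gramian A T b) = gamma_1 A T"
    then show "?scalar b" using maximizers by simp
  qed
qed

end
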